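(* Given elements $T,S\in\operatorname{H}_3(\mathbb{Q})$ and two finite subsets $\mathcal{G},\mathcal{H}$ of $\operatorname{H}_3(\mathbb{Q})$, it is decidable whether $T\cdot\langle\mathcal{G}\rangle\cap S\cdot\langle\mathcal{H}\rangle=\emptyset$.
   Context: $\operatorname{H}_3(\mathbb{Q})$ is the Heisenberg group of matrices $\begin{pmatrix}1&a&c\\0&1&b\\0&0&1\end{pmatrix}$ with $a,b,c\in\mathbb{Q}$. For a set $\mathcal{G}$ of matrices, $\langle\mathcal{G}\rangle$ is the semigroup generated by $\mathcal{G}$ (all products of non-empty finite sequences of elements of $\mathcal{G}$), and $T\cdot\langle\mathcal{G}\rangle=\{T\cdot s\mid s\in\langle\mathcal{G}\rangle\}$. *)

theory Defs
  imports "HOL-Analysis.Analysis" "HOL-Library.Nat_Bijection"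
begin

section \<open>Partial recursive functions and decidability\<close>

datatype recf =
    Zero
  | Succ
  | Proj nat
  | Comp recf "recf list"
  | PrimRec recf recf
  | Mu recf

text \<open>
  \<open>computes f xs y\<close>: the partial recursive function denoted by \<open>f\<close> is defined on the
  arguments \<open>xs\<close> and has value \<open>y\<close> there. Arities are not tracked: an ill-formed application,
  such as a projection beyond the argument list, is simply undefined.
  The recursion variable of \<open>PrimRec\<close> and the search variable of \<open>Mu\<close> come first. Minimisation is
  defined only if all the smaller candidates have a (nonzero) value.
\<close>

inductive computes :: "recf \<Rightarrow> nat list \<Rightarrow> nat \<Rightarrow> bool" where
  zero: "computes Zero xs 0"
| succ: "computes Succ [x] (Suc x)"
| proj: "i < length xs \<Longrightarrow> computes (Proj i) xs (xs ! i)"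
| comp: "list_all2 (\<lambda>g y. computes g xs y) gs ys \<Longrightarrow> computes f ys z
    \<Longrightarrow> computes (Comp f gs) xs z"
| prim_0: "computes f xs y \<Longrightarrow> computes (PrimRec f g) (0 # xs) y"
| prim_Suc: "computes (PrimRec f g) (n # xs) r \<Longrightarrow> computes g (n # r # xs) y
    \<Longrightarrow> computes (PrimRec f g) (Suc n # xs) y"
| mu: "computes f (n # xs) 0 \<Longrightarrow> (\<And>i. i < n \<Longrightarrow> \<exists>y. computes f (i # xs) (Suc y))
    \<Longrightarrow> computes (Mu f) xs n"

lemma computes_functional: "computes f xs y \<Longrightarrow> computes f xs z \<Longrightarrow> y = z"
proof (induction arbitrary: z rule: computes.induct)
  case (comp xs gs ys f y)
  from comp.prems obtain zs where zs: "list_all2 (\<lambda>g y. computes g xs y) gs zs"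
    and f: "computes f zs z"
    by (cases rule: computes.cases) auto
  have "ys = zs"
    using comp.IH(1) zs by (auto simp: list_all2_conv_all_nth intro!: nth_equalityI)
  with f comp.IH(2) show ?case by simp
next
  case (prim_Suc f g n xs r y)
  from prim_Suc.prems show ?case
    by (cases rule: computes.cases) (use prim_Suc.IH in blast)
next
  case (mu f n xs)
  from mu.prems obtain "computes f (z # xs) 0"
    and "\<And>i. i < z \<Longrightarrow> \<exists>y. computes f (i # xs) (Suc y)"
    by (cases rule: computes.cases) auto
  with mu.IH show ?case
    by (metis linorder_neqE_nat nat.distinct(1))
next
  case (zero xs)
  then show ?case by (cases rule: computes.cases) auto
next
  case (succ x)
  then show ?case by (cases rule: computes.cases) auto
next
  case (proj i xs)
  from proj.prems show ?case by (cases rule: computes.cases) auto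
next
  case (prim_0 f xs y g)
  from prim_0.prems show ?case
    by (cases rule: computes.cases) (use prim_0.IH in blast)
qed

text \<open>
  \<open>D\<close> is the set of instances of the problem, \<open>enc\<close> presents an instance to the algorithm. The
  algorithm must halt with the right answer on every instance; it need not recognise numbers that
  are not codes of instances.
\<close>

definition decidable_on :: "'a set \<Rightarrow> ('a \<Rightarrow> nat) \<Rightarrow> ('a \<Rightarrow> bool) \<Rightarrow> bool" where
  "decidable_on D enc P \<longleftrightarrow>
     (\<exists>f. \<forall>x\<in>D. computes f [enc x] (if P x then 1 else 0))"


section \<open>The Heisenberg group over the rationals\<close>

definition heis :: "rat \<Rightarrow> rat \<Rightarrow> rat \<Rightarrow> rat^3^3" where
  "heis a b c = vector [vector [1, a, c],
                        vector [0, 1, b],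
                        vector [0, 0, 1]]"

definition H3 :: "(rat^3^3) set" where
  "H3 = {heis a b c | a b c. True}"

text \<open>
  The class operation \<open>*\<close> on this type is componentwise, so products of sequences are
  folded with the matrix product \<open>**\<close>.
\<close>

definition semigroup_gen :: "(rat^3^3) set \<Rightarrow> (rat^3^3) set" where
  "semigroup_gen G = {foldr (**) Ms (mat 1) | Ms. Ms \<noteq> [] \<and> set Ms \<subseteq> G}"


section \<open>Codes of problem instances\<close>

definition rat_code :: "rat \<Rightarrow> nat" where
  "rat_code q = (case quotient_of q of (n, d) \<Rightarrow> prod_encode (int_encode n, nat d))"

text \<open>
  Only the three entries above the diagonal are recorded, which determine a matrix in \<open>H3\<close>.
\<close>

definition heis_code :: "rat^3^3 \<Rightarrow> nat" where
  "heis_code M =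
     prod_encode (rat_code (M$1$2), prod_encode (rat_code (M$2$3), rat_code (M$1$3)))"

text \<open>
  An instance consists of the two elements and of a list enumerating each of the two finite
  sets, in any order and possibly with repetitions.
\<close>

type_synonym coset_instance =
  "(rat^3^3) \<times> (rat^3^3) \<times> (rat^3^3) list \<times> (rat^3^3) list"

definition coset_instances :: "coset_instance set" where
  "coset_instances = H3 \<times> H3 \<times> lists H3 \<times> lists H3"

fun instance_code :: "coset_instance \<Rightarrow> nat" where
  "instance_code (T, S, Gs, Hs) =
     prod_encode (heis_code T, prod_encode (heis_code S,
       prod_encode (list_encode (map heis_code Gs), list_encode (map heis_code Hs))))"

lemma heis_nth [simp]:
  "heis a b c $ 1 $ 1 = 1" "heis a b c $ 1 $ 2 = a" "heis a b c $ 1 $ 3 = c"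
  "heis a b c $ 2 $ 1 = 0" "heis a b c $ 2 $ 2 = 1" "heis a b c $ 2 $ 3 = b"
  "heis a b c $ 3 $ 1 = 0" "heis a b c $ 3 $ 2 = 0" "heis a b c $ 3 $ 3 = 1"
  by (simp_all add: heis_def vector_3)

lemma heis_mult: "heis a b c ** heis a' b' c' = heis (a + a') (b + b') (c + c' + a * b')"
  by (simp add: vec_eq_iff matrix_matrix_mult_def sum_3 forall_3)

lemma inj_rat_code: "inj rat_code"
proof (rule injI)
  fix p q assume eq: "rat_code p = rat_code q"
  obtain n d where p: "quotient_of p = (n, d)" by fastforce
  obtain n' d' where q: "quotient_of q = (n', d')" by fastforce
  have "d > 0" "d' > 0" using p q quotient_of_denom_pos by blast+
  with eq have "quotient_of p = quotient_of q"
    by (auto simp: rat_code_def p q inj_eq[OF inj_int_encode])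
  then show "p = q" by (simp add: quotient_of_inject)
qed

lemma inj_on_heis_code: "inj_on heis_code H3"
  by (auto simp: inj_on_def H3_def heis_code_def inj_eq[OF inj_rat_code])

lemma inj_on_instance_code: "inj_on instance_code coset_instances"
proof (rule inj_onI)
  fix x y
  assume x: "x \<in> coset_instances" and y: "y \<in> coset_instances"
    and eq: "instance_code x = instance_code y"
  obtain T S Gs Hs where x': "x = (T, S, Gs, Hs)" by (cases x)
  obtain T' S' Gs' Hs' where y': "y = (T', S', Gs', Hs')" by (cases y)
  have heis_list: "As = Bs"
    if "map heis_code As = map heis_code Bs" "As \<in> lists H3" "Bs \<in> lists H3" for As Bs
    using that map_inj_on[of heis_code As Bs] inj_on_subset[OF inj_on_heis_code]
    by (metis Un_least in_lists_conv_set subsetI)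
  have "heis_code T = heis_code T'" "heis_code S = heis_code S'"
    "map heis_code Gs = map heis_code Gs'" "map heis_code Hs = map heis_code Hs'"
    using eq by (simp_all add: x' y' inj_eq[OF inj_list_encode[of UNIV]])
  then show "x = y"
    using x y heis_list inj_on_heis_code
    by (simp add: x' y' coset_instances_def inj_on_eq_iff)
qed

end

theory Submission
  imports Defs "HOL-Library.Multiset"
begin

text \<open>
  Rescaling the coordinates makes all matrices integral, and replacing the corner entry \<open>c\<close> by
  \<open>z = 2 c - a b\<close> turns the group law into
  \<open>(a, b, z) (a', b', z') = (a + a', b + b', z + z' + (a b' - b a'))\<close>.
  If the two orbits meet at all, they meet in words of computably bounded length, so that a bounded
  search decides the problem.

  For the bound, split a solution into pieces of bounded length: one that accounts for the two
  base points, and others that contribute equally to the first two coordinates on both sides.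
  If the letters of the latter pieces commute with each other on each side, the equation for \<open>z\<close>
  is linear in these letters once the remaining ones, of which there are boundedly many, stay at
  their places, and all but boundedly many of them can be dropped. If two of them do not commute,
  let \<open>d\<close> be their commutator. It is then enough to solve the equation for \<open>z\<close> modulo \<open>2 d\<close> by
  short words: appending balanced pieces and reordering the two letters changes the difference
  in \<open>z\<close> by every multiple of \<open>2 d\<close> in a range that grows quadratically with the number of
  pieces, which beats the linear growth of everything else.
\<close>

section \<open>Zero-sum decompositions\<close>

text \<open>The splitting into bounded pieces rests on a pigeonhole: a zero-sum list of bounded
  integers can be ordered so that its partial sums stay bounded, hence it contains a short zero-sum
  sublist. Further coordinates are treated one at a time, with the pieces found so far as new
  letters; the base points enter as one letter of their own.

  Letters of different sides never interact, since the equation for \<open>z\<close> only compares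
  one word with the other; so commutation matters on each side separately. Exchanging two adjacent
  letters changes \<open>z\<close> by twice their cross product, whence the modulus
  \<open>2 d\<close> and not \<open>d\<close>.

  Shortening words modulo \<open>2 d\<close> is delicate because a deleted factor leaves cross terms
  with its surroundings. The deleted factors are therefore trivial modulo \<open>2 d\<close> in all
  three coordinates. The same property makes it harmless to put some of them back, which restores
  the exact equality of the first two coordinates.

  All length bounds depend only on a bound \<open>K\<close> for the letters, and \<open>K\<close> is
  computed from the code of the instance, so the search itself needs no case distinction.\<close>

lemma sum_list_map_mset_eq:
  fixes f :: "'a \<Rightarrow> 'b::comm_monoid_add"
  assumes "mset xs = mset ys"
  shows "sum_list (map f xs) = sum_list (map f ys)"
proof -
  have "sum_mset (image_mset f (mset xs)) = sum_mset (image_mset f (mset ys))"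
    using assms by simp
  then show ?thesis by (simp only: mset_map[symmetric] sum_mset_sum_list)
qed

text \<open>Greedy choice, as in the one-dimensional Steinitz lemma: the remaining entries sum to
  \<open>- p\<close>, so one of them leads from \<open>p\<close> back towards 0 and cannot overshoot
  by more than \<open>m\<close>.\<close>

lemma balanced_order:
  fixes f :: "'a \<Rightarrow> int"
  assumes "\<forall>x\<in>set xs. \<bar>f x\<bar> \<le> m" "\<bar>p\<bar> \<le> m" "p + sum_list (map f xs) = 0"
  shows "\<exists>ys. mset ys = mset xs \<and> (\<forall>k\<le>length ys. \<bar>p + sum_list (map f (take k ys))\<bar> \<le> m)"
  using assms
proof (induction "length xs" arbitrary: xs p)
  case 0
  then show ?case by (intro exI[of _ "[]"]) simp
next
  case (Suc n)
  have "\<exists>x\<in>set xs. \<bar>p + f x\<bar> \<le> m"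
  proof (cases "p > 0")
    case True
    have "\<exists>x\<in>set xs. f x \<le> 0"
    proof (rule ccontr)
      assume "\<not> ?thesis"
      then have "sum_list (map f xs) \<ge> 0" by (intro sum_list_nonneg) force
      with True Suc.prems(3) show False by simp
    qed
    then obtain x where "x \<in> set xs" "f x \<le> 0" by blast
    with True Suc.prems(1,2) show ?thesis by (intro bexI[of _ x]) force+
  next
    case False
    have "\<exists>x\<in>set xs. f x \<ge> 0"
    proof (rule ccontr)
      assume neg: "\<not> ?thesis"
      \<comment> \<open>Here \<open>p\<close> may be 0, so the contradiction needs a strictly
        negative entry, which exists because \<open>xs\<close> is nonempty.\<close>
      from Suc.hyps(2) obtain y ys where xs: "xs = y # ys" by (cases xs) auto
      have "sum_list (map (\<lambda>x. - f x) ys) \<ge> 0" using neg xs by (intro sum_list_nonneg) force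
      then have "sum_list (map f ys) \<le> 0" by (simp add: uminus_sum_list_map[symmetric, unfolded o_def])
      moreover have "f y < 0" using neg xs by force
      ultimately show False using False Suc.prems(3) xs by simp
    qed
    then obtain x where "x \<in> set xs" "f x \<ge> 0" by blast
    with False Suc.prems(1,2) show ?thesis by (intro bexI[of _ x]) force+
  qed
  then obtain x where x: "x \<in> set xs" "\<bar>p + f x\<bar> \<le> m" by blast
  have "sum_list (map f xs) = f x + sum_list (map f (remove1 x xs))"
    by (rule sum_list_map_remove1[OF x(1)])
  then have "p + f x + sum_list (map f (remove1 x xs)) = 0"
    using Suc.prems(3) by simp
  moreover have "n = length (remove1 x xs)"
    using Suc.hyps(2) x(1) by (simp add: length_remove1)
  ultimately obtain ys where ys: "mset ys = mset (remove1 x xs)"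
    "\<forall>k\<le>length ys. \<bar>p + f x + sum_list (map f (take k ys))\<bar> \<le> m"
    using Suc.hyps(1)[of "remove1 x xs" "p + f x"] Suc.prems(1) x(2)
    by (meson notin_set_remove1)
  show ?case
  proof (intro exI[of _ "x # ys"] conjI allI impI)
    show "mset (x # ys) = mset xs" using ys(1) x(1) by simp
    fix k assume "k \<le> length (x # ys)"
    then show "\<bar>p + sum_list (map f (take k (x # ys)))\<bar> \<le> m"
      using ys(2) Suc.prems(2) by (cases k) (auto simp: add.assoc)
  qed
qed

text \<open>Pigeonhole on the \<open>card S + 1\<close> shortest prefixes. The state
  \<open>st\<close> is left abstract: it will be a partial sum in one place and a triple of residues
  in another.\<close>

lemma prefix_repeat:
  assumes "finite S" "\<And>k. k \<le> length xs \<Longrightarrow> st (take k xs) \<in> S" "card S \<le> length xs"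
  obtains u v w where "xs = u @ v @ w" "v \<noteq> []" "length v \<le> card S" "st (u @ v) = st u"
proof -
  have "\<not> inj_on (\<lambda>k. st (take k xs)) {..card S}"
  proof
    assume "inj_on (\<lambda>k. st (take k xs)) {..card S}"
    then have "card {..card S} \<le> card S"
      by (rule card_inj_on_le) (use assms in auto)
    then show False by simp
  qed
  then obtain i j where ij: "i < j" "j \<le> card S" "st (take j xs) = st (take i xs)"
    unfolding inj_on_def by (metis atMost_iff linorder_neqE_nat)
  show ?thesis
  proof (rule that)
    have "take j xs = take i xs @ take (j - i) (drop i xs)"
      using ij(1) take_add[of i "j - i" xs] by simp
    then show "st (take i xs @ take (j - i) (drop i xs)) = st (take i xs)"
      using ij(3) by simp
    show "xs = take i xs @ take (j - i) (drop i xs) @ drop (j - i) (drop i xs)"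
      by (simp only: append_take_drop_id)
  qed (use ij assms(3) in auto)
qed

text \<open>In a balanced order two prefixes have the same sum; the factor between them is a
  zero-sum piece, and so is what remains after its removal. The bound \<open>2 * m + 1\<close> is
  the number of integers between \<open>- m\<close> and \<open>m\<close>.\<close>

lemma zero_sum_split_single:
  fixes f :: "'a \<Rightarrow> int"
  assumes "\<forall>x\<in>set xs. \<bar>f x\<bar> \<le> int m" "sum_list (map f xs) = 0"
  shows "\<exists>xss. mset (concat xss) = mset xs \<and>
    (\<forall>ys\<in>set xss. ys \<noteq> [] \<and> length ys \<le> 2 * m + 1 \<and> sum_list (map f ys) = 0)"
  using assms
proof (induction "length xs" arbitrary: xs rule: less_induct)
  case less
  consider "xs = []" | "xs \<noteq> []" "length xs < 2 * m + 1" | "2 * m + 1 \<le> length xs" by linarith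
  then show ?case
  proof cases
    case 1
    then show ?thesis by (intro exI[of _ "[]"]) simp
  next
    case 2
    with less.prems show ?thesis by (intro exI[of _ "[xs]"]) simp
  next
    case 3
    obtain ys where ys: "mset ys = mset xs"
      and bal: "\<forall>k\<le>length ys. \<bar>0 + sum_list (map f (take k ys))\<bar> \<le> int m"
      using balanced_order[of xs f "int m" 0] less.prems by auto
    have len: "length ys = length xs" using ys by (rule mset_eq_length)
    have card: "card {- int m..int m} = 2 * m + 1" by simp
    obtain u v w where uvw: "ys = u @ v @ w" "v \<noteq> []" "length v \<le> 2 * m + 1"
      "sum_list (map f (u @ v)) = sum_list (map f u)"
    proof (rule prefix_repeat[of "{- int m..int m}" ys "\<lambda>w. sum_list (map f w)"])
      show "card {- int m..int m} \<le> length ys" using 3 len by simp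
      fix k assume "k \<le> length ys"
      with bal show "sum_list (map f (take k ys)) \<in> {- int m..int m}"
        by (auto simp: abs_le_iff)
    qed (use card in auto)
    have v0: "sum_list (map f v) = 0" using uvw(4) by simp
    have mset_xs: "mset xs = mset v + mset (u @ w)" using ys[symmetric] uvw(1) by simp
    have sum_eq: "sum_list (map f xs) = sum_list (map f ys)"
      using sum_list_map_mset_eq[OF ys, of f] by simp
    have "length (u @ w) < length xs" using len[symmetric] uvw(1,2) by simp
    moreover have "\<forall>x\<in>set (u @ w). \<bar>f x\<bar> \<le> int m"
      using less.prems(1) mset_eq_setD[OF ys] uvw(1) by auto
    moreover have "sum_list (map f (u @ w)) = 0"
      using sum_eq less.prems(2) uvw(1) v0 by simp
    ultimately obtain xss where "mset (concat xss) = mset (u @ w)"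
      "\<forall>ys\<in>set xss. ys \<noteq> [] \<and> length ys \<le> 2 * m + 1 \<and> sum_list (map f ys) = 0"
      using less.hyps by blast
    then show ?thesis
      using v0 uvw(2,3) mset_xs by (intro exI[of _ "v # xss"]) simp
  qed
qed

text \<open>Pieces of length at most \<open>b\<close> that are balanced for \<open>k\<close>
  functionals have values up to \<open>m * b\<close> under the next one, so
  \<open>2 * (m * b) + 1\<close> of them suffice for a piece balanced for all
  \<open>k + 1\<close>.\<close>

fun zero_sum_bound :: "nat \<Rightarrow> nat \<Rightarrow> nat" where
  "zero_sum_bound m 0 = 1"
| "zero_sum_bound m (Suc k) = zero_sum_bound m k * (2 * (m * zero_sum_bound m k) + 1)"

lemma abs_sum_list_le:
  fixes f :: "'a \<Rightarrow> int"
  assumes "\<forall>x\<in>set xs. \<bar>f x\<bar> \<le> int m" "length xs \<le> n"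
  shows "\<bar>sum_list (map f xs)\<bar> \<le> int (n * m)"
proof -
  have "\<bar>sum_list (map f xs)\<bar> \<le> int (length xs * m)"
    using assms(1) by (induction xs) (auto simp: algebra_simps)
  also have "\<dots> \<le> int (n * m)" using assms(2) by (simp only: of_nat_le_iff mult_le_mono1)
  finally show ?thesis .
qed

lemma length_concat_le:
  "\<forall>x\<in>set xss. length x \<le> m \<Longrightarrow> length xss \<le> n \<Longrightarrow> length (concat xss) \<le> m * n"
proof -
  assume "\<forall>x\<in>set xss. length x \<le> m" "length xss \<le> n"
  then have "length (concat xss) \<le> m * length xss"
    by (induction xss arbitrary: n) (fastforce simp: add_mono)+
  also have "\<dots> \<le> m * n" using \<open>length xss \<le> n\<close> by simp
  finally show ?thesis .
qed

lemma sum_list_map_concat: "sum_list (map f (concat xss)) = sum_list (map (\<lambda>xs. sum_list (map f xs)) xss)"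
  by (induction xss) auto

text \<open>The pieces for \<open>fs\<close> serve as the letters of a one-dimensional problem for
  \<open>f\<close>; grouping them preserves the zero sums already achieved.\<close>

lemma zero_sum_split:
  fixes fs :: "('a \<Rightarrow> int) list"
  assumes "\<forall>f\<in>set fs. \<forall>x\<in>set xs. \<bar>f x\<bar> \<le> int m" "\<forall>f\<in>set fs. sum_list (map f xs) = 0"
  shows "\<exists>xss. mset (concat xss) = mset xs \<and>
    (\<forall>ys\<in>set xss. ys \<noteq> [] \<and> length ys \<le> zero_sum_bound m (length fs) \<and>
      (\<forall>f\<in>set fs. sum_list (map f ys) = 0))"
  using assms
proof (induction fs)
  case Nil
  have "concat (map (\<lambda>x. [x]) xs) = xs" by (induction xs) auto
  then show ?case by (intro exI[of _ "map (\<lambda>x. [x]) xs"]) auto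
next
  case (Cons f fs)
  let ?b = "zero_sum_bound m (length fs)"
  obtain xss where xss: "mset (concat xss) = mset xs"
    "\<forall>ys\<in>set xss. ys \<noteq> [] \<and> length ys \<le> ?b \<and> (\<forall>f\<in>set fs. sum_list (map f ys) = 0)"
    using Cons by auto
  have set_xss: "set (concat xss) = set xs" using xss(1) by (rule mset_eq_setD)
  have "\<forall>ys\<in>set xss. \<bar>sum_list (map f ys)\<bar> \<le> int (m * ?b)"
  proof
    fix ys assume ys: "ys \<in> set xss"
    then have "\<forall>x\<in>set ys. \<bar>f x\<bar> \<le> int m"
      using Cons.prems(1) set_xss by auto
    then show "\<bar>sum_list (map f ys)\<bar> \<le> int (m * ?b)"
      using abs_sum_list_le[of ys f m ?b] xss(2) ys by (simp add: mult.commute)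
  qed
  moreover have "sum_list (map (\<lambda>ys. sum_list (map f ys)) xss) = 0"
    using Cons.prems(2) sum_list_map_mset_eq[OF xss(1), of f]
    by (simp add: sum_list_map_concat[symmetric])
  ultimately obtain xsss where xsss: "mset (concat xsss) = mset xss"
    "\<forall>yss\<in>set xsss. yss \<noteq> [] \<and> length yss \<le> 2 * (m * ?b) + 1 \<and>
      sum_list (map (\<lambda>ys. sum_list (map f ys)) yss) = 0"
    using zero_sum_split_single[of xss "\<lambda>ys. sum_list (map f ys)" "m * ?b"] by blast
  have set_xsss: "set (concat xsss) = set xss" using xsss(1) by (rule mset_eq_setD)
  show ?case
  proof (intro exI[of _ "map concat xsss"] conjI ballI)
    have "mset (concat (map concat xsss)) = mset (concat (concat xsss))"
      by (induction xsss) auto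
    also have "\<dots> = mset (concat xss)"
      unfolding mset_concat using xsss(1) by (rule sum_list_map_mset_eq)
    finally show "mset (concat (map concat xsss)) = mset xs" using xss(1) by simp
    fix ys assume "ys \<in> set (map concat xsss)"
    then obtain yss where yss: "yss \<in> set xsss" "ys = concat yss" by auto
    then have sub: "set yss \<subseteq> set xss" using set_xsss by auto
    show "ys \<noteq> []"
    proof -
      have "yss \<noteq> []" using yss(1) xsss(2) by blast
      then have "hd yss \<in> set yss" by simp
      then show ?thesis using sub xss(2) yss(2) by fastforce
    qed
    show "length ys \<le> zero_sum_bound m (length (f # fs))"
      unfolding yss(2) list.size zero_sum_bound.simps
      using length_concat_le[of yss ?b "2 * (m * ?b) + 1"] sub xss(2) xsss(2) yss(1) by auto
    fix h assume "h \<in> set (f # fs)"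
    then consider "h = f" | "h \<in> set fs" by auto
    then show "sum_list (map h ys) = 0"
    proof cases
      case 1
      then show ?thesis using xsss(2) yss by (simp add: sum_list_map_concat)
    next
      case 2
      then have "map (\<lambda>ys. sum_list (map h ys)) yss = map (\<lambda>_. 0) yss"
        using sub xss(2) by auto
      then have "sum_list (map (\<lambda>ys. sum_list (map h ys)) yss) = 0"
        by (simp only: sum_list_triv mult_zero_right)
      then show ?thesis using yss(2) by (simp only: sum_list_map_concat)
    qed
  qed
qed

text \<open>The constants become the values of an extra letter \<open>None\<close>;
  \<open>ys\<close> is the piece containing it, without it. Losing \<open>None\<close> makes the
  length bound strict, which later leaves room for the base letter.\<close>

lemma zero_sum_split_affine:
  fixes fcs :: "(('a \<Rightarrow> int) \<times> int) list"
  assumes "\<And>f c. (f, c) \<in> set fcs \<Longrightarrow> (\<forall>x\<in>set xs. \<bar>f x\<bar> \<le> int m) \<and> \<bar>c\<bar> \<le> int m \<and>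
      c + sum_list (map f xs) = 0"
  obtains ys xss where "mset (ys @ concat xss) = mset xs"
    "length ys < zero_sum_bound m (length fcs)"
    "\<And>f c. (f, c) \<in> set fcs \<Longrightarrow> c + sum_list (map f ys) = 0"
    "\<And>zs. zs \<in> set xss \<Longrightarrow> length zs \<le> zero_sum_bound m (length fcs)"
    "\<And>f c zs. (f, c) \<in> set fcs \<Longrightarrow> zs \<in> set xss \<Longrightarrow> sum_list (map f zs) = 0"
proof -
  define ext :: "(('a \<Rightarrow> int) \<times> int) \<Rightarrow> 'a option \<Rightarrow> int" where
    "ext = (\<lambda>(f, c) x. case x of None \<Rightarrow> c | Some x \<Rightarrow> f x)"
  have ext_Some: "map (ext (f, c)) (map Some zs) = map f zs" for f c zs
    by (auto simp: ext_def)
  let ?xs = "None # map Some xs"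
  have "\<exists>xss. mset (concat xss) = mset ?xs \<and>
    (\<forall>ys\<in>set xss. ys \<noteq> [] \<and> length ys \<le> zero_sum_bound m (length (map ext fcs)) \<and>
      (\<forall>f\<in>set (map ext fcs). sum_list (map f ys) = 0))"
  proof (rule zero_sum_split)
    show "\<forall>f\<in>set (map ext fcs). \<forall>x\<in>set ?xs. \<bar>f x\<bar> \<le> int m"
      using assms by (auto simp: ext_def)
    show "\<forall>f\<in>set (map ext fcs). sum_list (map f ?xs) = 0"
      using assms by (auto simp: ext_def o_def)
  qed
  then obtain xss where xss: "mset (concat xss) = mset ?xs"
    and len: "\<And>ys. ys \<in> set xss \<Longrightarrow> length ys \<le> zero_sum_bound m (length fcs)"
    and zero: "\<And>ys fc. ys \<in> set xss \<Longrightarrow> fc \<in> set fcs \<Longrightarrow> sum_list (map (ext fc) ys) = 0"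
    by auto
  have "None \<in> set (concat xss)" using mset_eq_setD[OF xss] by simp
  then obtain p where p: "p \<in> set xss" "None \<in> set p" by auto
  let ?q = "remove1 None p" and ?rest = "remove1 p xss"
  have "mset (None # map Some xs) = mset p + mset (concat ?rest)"
    unfolding xss[symmetric] mset_concat by (rule sum_list_map_remove1[OF p(1)])
  also have "mset p = mset (None # ?q)" using p(2) by simp
  finally have ms: "mset (?q @ concat ?rest) = mset (map Some xs)"
    by (simp only: mset.simps mset_append union_mset_add_mset_left add_mset_add_mset_same_iff)
  then have sets: "set ?q \<union> set (concat ?rest) = Some ` set xs"
    using mset_eq_setD[OF ms] by simp
  have Some_the: "zs = map Some (map the zs)" if "set zs \<subseteq> Some ` set xs" for zs
    using that by (induction zs) auto
  have q: "?q = map Some (map the ?q)" using Some_the sets by blast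
  have rest: "zs = map Some (map the zs)" if "zs \<in> set ?rest" for zs
    using that sets by (intro Some_the) auto
  show ?thesis
  proof
    have "mset (map the (?q @ concat ?rest)) = mset (map the (map Some xs))"
      using ms by (simp only: mset_map)
    then show "mset (map the ?q @ concat (map (map the) ?rest)) = mset xs"
      by (simp add: map_concat o_def)
    have "length ?q < length p" using p(2) length_pos_if_in_set[OF p(2)] by (simp add: length_remove1)
    then show "length (map the ?q) < zero_sum_bound m (length fcs)"
      using len[OF p(1)] by simp
    show "c + sum_list (map f (map the ?q)) = 0" if "(f, c) \<in> set fcs" for f c
    proof -
      have "sum_list (map (ext (f, c)) p) = ext (f, c) None + sum_list (map (ext (f, c)) ?q)"
        by (rule sum_list_map_remove1[OF p(2)])
      also have "map (ext (f, c)) ?q = map f (map the ?q)"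
        by (subst q) (rule ext_Some)
      finally show ?thesis using zero[OF p(1) that] by (simp add: ext_def)
    qed
    fix zs assume "zs \<in> set (map (map the) ?rest)"
    then obtain zs' where zs': "zs' \<in> set ?rest" "zs = map the zs'" by auto
    then have "zs' \<in> set xss" by (meson notin_set_remove1)
    show "length zs \<le> zero_sum_bound m (length fcs)"
      using len[OF \<open>zs' \<in> set xss\<close>] zs'(2) by simp
    show "sum_list (map f zs) = 0" if "(f, c) \<in> set fcs" for f c
    proof -
      have "map (ext (f, c)) zs' = map f zs"
        unfolding zs'(2) by (subst rest[OF zs'(1)]) (rule ext_Some)
      then show ?thesis using zero[OF \<open>zs' \<in> set xss\<close> that] by simp
    qed
  qed
qed

section \<open>Words over integer letters\<close>

text \<open>A letter is a rescaled matrix in the coordinates \<open>(a, b, 2 c - a b)\<close>.\<close>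

type_synonym letter = "int \<times> int \<times> int"

abbreviation lx :: "letter \<Rightarrow> int" where "lx l \<equiv> fst l"
abbreviation ly :: "letter \<Rightarrow> int" where "ly l \<equiv> fst (snd l)"
abbreviation lz :: "letter \<Rightarrow> int" where "lz l \<equiv> snd (snd l)"

text \<open>The symplectic form on the first two coordinates: replacing adjacent letters
  \<open>l\<close>, \<open>m\<close> by \<open>m\<close>, \<open>l\<close> lowers \<open>wz\<close>
  by \<open>2 * cross l m\<close>.\<close>

definition cross :: "letter \<Rightarrow> letter \<Rightarrow> int" where
  "cross l m = lx l * ly m - ly l * lx m"

primrec wx :: "letter list \<Rightarrow> int" where
  "wx [] = 0"
| "wx (l # w) = lx l + wx w"

primrec wy :: "letter list \<Rightarrow> int" where
  "wy [] = 0"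
| "wy (l # w) = ly l + wy w"

primrec wz :: "letter list \<Rightarrow> int" where
  "wz [] = 0"
| "wz (l # w) = lz l + wz w + (lx l * wy w - ly l * wx w)"

lemma wx_append [simp]: "wx (u @ v) = wx u + wx v"
  by (induction u) auto

lemma wy_append [simp]: "wy (u @ v) = wy u + wy v"
  by (induction u) auto

lemma wz_append [simp]: "wz (u @ v) = wz u + wz v + (wx u * wy v - wy u * wx v)"
  by (induction u) (auto simp: algebra_simps)

lemma wx_conv_sum_list: "wx w = sum_list (map lx w)"
  by (induction w) auto

lemma wy_conv_sum_list: "wy w = sum_list (map ly w)"
  by (induction w) auto

lemma wx_concat: "wx (concat ws) = sum_list (map wx ws)"
  by (induction ws) auto

lemma wy_concat: "wy (concat ws) = sum_list (map wy ws)"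
  by (induction ws) auto

lemma wx_mset_eq: "mset u = mset v \<Longrightarrow> wx u = wx v"
  unfolding wx_conv_sum_list by (rule sum_list_map_mset_eq)

lemma wy_mset_eq: "mset u = mset v \<Longrightarrow> wy u = wy v"
  unfolding wy_conv_sum_list by (rule sum_list_map_mset_eq)

lemma wx_power [simp]: "wx (concat (replicate n w)) = int n * wx w"
  by (induction n) (auto simp: algebra_simps)

lemma wy_power [simp]: "wy (concat (replicate n w)) = int n * wy w"
  by (induction n) (auto simp: algebra_simps)

text \<open>A word has no cross term with its own powers. In the matrix entry \<open>c\<close> a
  term quadratic in \<open>n\<close> would appear; this is what the coordinate
  \<open>2 c - a b\<close> buys.\<close>

lemma wz_power [simp]: "wz (concat (replicate n w)) = int n * wz w"
  by (induction n) (auto simp: algebra_simps)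

lemma word_replicate [simp]:
  "wx (replicate n l) = int n * lx l" "wy (replicate n l) = int n * ly l"
  "wz (replicate n l) = int n * lz l"
  by (induction n) (auto simp: algebra_simps)

definition letter_le :: "nat \<Rightarrow> letter \<Rightarrow> bool" where
  "letter_le K l \<longleftrightarrow> \<bar>lx l\<bar> \<le> int K \<and> \<bar>ly l\<bar> \<le> int K \<and> \<bar>lz l\<bar> \<le> int K"

lemma abs_cross_le:
  assumes "letter_le K l" "letter_le K m"
  shows "\<bar>cross l m\<bar> \<le> int (2 * K * K)"
proof -
  have "\<bar>lx l * ly m\<bar> \<le> int K * int K" "\<bar>ly l * lx m\<bar> \<le> int K * int K"
    using assms unfolding letter_le_def abs_mult by (auto intro!: mult_mono)
  then show ?thesis unfolding cross_def by simp
qed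

lemma abs_wx_le: "\<forall>l\<in>set w. letter_le K l \<Longrightarrow> length w \<le> n \<Longrightarrow> \<bar>wx w\<bar> \<le> int (n * K)"
  unfolding wx_conv_sum_list by (rule abs_sum_list_le) (auto simp: letter_le_def)

lemma abs_wy_le: "\<forall>l\<in>set w. letter_le K l \<Longrightarrow> length w \<le> n \<Longrightarrow> \<bar>wy w\<bar> \<le> int (n * K)"
  unfolding wy_conv_sum_list by (rule abs_sum_list_le) (auto simp: letter_le_def)

text \<open>Each of \<open>n\<close> letters contributes at most \<open>K\<close> by itself and
  \<open>2 * K * (n * K)\<close> by its cross term with the letters behind it.\<close>

definition wz_bound :: "nat \<Rightarrow> nat \<Rightarrow> nat" where
  "wz_bound K n = n * (K + 2 * K * (n * K))"

lemma abs_wz_le: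
  assumes "\<forall>l\<in>set w. letter_le K l" "length w \<le> n"
  shows "\<bar>wz w\<bar> \<le> int (wz_bound K n)"
proof -
  have "\<bar>wz w\<bar> \<le> int (length w * (K + 2 * K * (n * K)))"
    using assms
  proof (induction w)
    case (Cons l w)
    have w: "\<bar>wx w\<bar> \<le> int (n * K)" "\<bar>wy w\<bar> \<le> int (n * K)"
      using Cons.prems abs_wx_le[of w K n] abs_wy_le[of w K n] by auto
    have l: "\<bar>lx l\<bar> \<le> int K" "\<bar>ly l\<bar> \<le> int K" "\<bar>lz l\<bar> \<le> int K"
      using Cons.prems by (auto simp: letter_le_def)
    have "\<bar>lx l * wy w\<bar> \<le> int K * int (n * K)" "\<bar>ly l * wx w\<bar> \<le> int K * int (n * K)"
      unfolding abs_mult using w l by (intro mult_mono; simp)+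
    moreover have "\<bar>wz w\<bar> \<le> int (length w * (K + 2 * K * (n * K)))"
      using Cons by simp
    ultimately show ?case using l(3) by (simp add: algebra_simps)
  qed simp
  also have "\<dots> \<le> int (wz_bound K n)"
    unfolding wz_bound_def of_nat_le_iff by (rule mult_le_mono1[OF assms(2)])
  finally show ?thesis .
qed

subsection \<open>Subwords\<close>

lemma nths_snoc: "nths (w @ [l]) A = nths w A @ (if length w \<in> A then [l] else [])"
  by (simp add: nths_append)

lemma sum_list_map_nths:
  assumes "A \<subseteq> {..<length w}"
  shows "sum_list (map f (nths w A)) = (\<Sum>p\<in>A. f (w ! p))"
proof -
  have "sum_list (map f (nths w A)) = (\<Sum>p\<in>A \<inter> {..<length w}. f (w ! p))" for A
  proof (induction w rule: rev_induct)
    case (snoc l w)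
    have "(\<Sum>p\<in>A \<inter> {..<length w}. f ((w @ [l]) ! p)) = (\<Sum>p\<in>A \<inter> {..<length w}. f (w ! p))"
      by (intro sum.cong) (auto simp: nth_append)
    moreover have "A \<inter> {..<Suc (length w)} =
        (if length w \<in> A then insert (length w) (A \<inter> {..<length w}) else A \<inter> {..<length w})"
      by (auto simp: less_Suc_eq)
    ultimately show ?case using snoc by (simp add: nths_snoc add.commute)
  qed simp
  then show ?thesis using assms by (simp add: Int_absorb2)
qed

text \<open>Subwords are given by sets of positions rather than of letters, because the effect of a
  letter on \<open>wz\<close> depends on where it stands.\<close>

definition cross_sum :: "letter list \<Rightarrow> nat set \<Rightarrow> nat set \<Rightarrow> int" where
  "cross_sum w A B = (\<Sum>p\<in>A. \<Sum>q\<in>B. if p < q then cross (w ! p) (w ! q) else 0)"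

lemma wz_nths:
  assumes "A \<subseteq> {..<length w}"
  shows "wz (nths w A) = (\<Sum>p\<in>A. lz (w ! p)) + cross_sum w A A"
proof -
  \<comment> \<open>\<open>A\<close> may reach beyond the word here, since it stays fixed while the
    induction shortens the word at its end.\<close>
  have "wz (nths w A) = (\<Sum>p\<in>A \<inter> {..<length w}. lz (w ! p))
      + cross_sum w (A \<inter> {..<length w}) (A \<inter> {..<length w})" for A
  proof (induction w rule: rev_induct)
    case (snoc l w)
    let ?A = "A \<inter> {..<length w}"
    have z: "(\<Sum>p\<in>?A. lz ((w @ [l]) ! p)) = (\<Sum>p\<in>?A. lz (w ! p))"
      by (intro sum.cong) (auto simp: nth_append)
    have c: "cross_sum (w @ [l]) ?A ?A = cross_sum w ?A ?A"
      unfolding cross_sum_def by (intro sum.cong) (auto simp: nth_append)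
    show ?case
    proof (cases "length w \<in> A")
      case True
      have A: "A \<inter> {..<length (w @ [l])} = insert (length w) ?A"
        using True by (auto simp: less_Suc_eq)
      have "nths w A = nths w ?A"
        unfolding nths_def by (rule arg_cong[where f = "map fst"], rule filter_cong) (auto dest: set_zip_rightD)
      then have xy: "wx (nths w A) = (\<Sum>p\<in>?A. lx (w ! p))" "wy (nths w A) = (\<Sum>p\<in>?A. ly (w ! p))"
        unfolding wx_conv_sum_list wy_conv_sum_list by (simp_all add: sum_list_map_nths)
      \<comment> \<open>The last position precedes no other, so only its column contributes.\<close>
      have row: "(\<Sum>q\<in>insert (length w) ?A. if length w < q then cross ((w @ [l]) ! length w) ((w @ [l]) ! q) else 0) = 0"
        by (rule sum.neutral) auto
      have "cross_sum (w @ [l]) (insert (length w) ?A) (insert (length w) ?A)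
          = (\<Sum>p\<in>?A. cross ((w @ [l]) ! p) l + (\<Sum>q\<in>?A. if p < q then cross ((w @ [l]) ! p) ((w @ [l]) ! q) else 0))"
        unfolding cross_sum_def by (subst sum.insert, simp, simp, subst row) (auto intro!: sum.cong)
      also have "\<dots> = (\<Sum>p\<in>?A. cross (w ! p) l) + cross_sum w ?A ?A"
        unfolding sum.distrib c[symmetric] cross_sum_def[symmetric]
        by (simp, intro sum.cong) (auto simp: nth_append)
      also have "(\<Sum>p\<in>?A. cross (w ! p) l) = wx (nths w A) * ly l - wy (nths w A) * lx l"
        unfolding xy cross_def by (simp add: sum_subtractf sum_distrib_right)
      finally show ?thesis using True snoc z unfolding A by (simp add: nths_snoc)
    next
      case False
      then have A: "A \<inter> {..<length (w @ [l])} = ?A" by (auto simp: less_Suc_eq)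
      from False show ?thesis unfolding A z c using snoc by (simp add: nths_snoc)
    qed
  qed (simp add: cross_sum_def)
  then show ?thesis using assms by (simp add: Int_absorb2)
qed

text \<open>The change of \<^const>\<open>wz\<close> when position \<open>p\<close> is added to the subword at the positions \<open>F\<close>.\<close>

definition twist :: "letter list \<Rightarrow> nat set \<Rightarrow> nat \<Rightarrow> int" where
  "twist w F p = lz (w ! p) +
     (\<Sum>q\<in>F. if q < p then cross (w ! q) (w ! p) else cross (w ! p) (w ! q))"

text \<open>\<open>wz\<close> is quadratic in the set of positions. Its terms of second order in
  \<open>P\<close> come from pairs inside \<open>P\<close> and vanish by commutation, which leaves
  an affine function of \<open>P\<close>.\<close>

lemma wz_nths_Un:
  assumes "F \<subseteq> {..<length w}" "P \<subseteq> {..<length w}" "F \<inter> P = {}"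
    and commute: "\<And>p q. p \<in> P \<Longrightarrow> q \<in> P \<Longrightarrow> cross (w ! p) (w ! q) = 0"
  shows "wz (nths w (F \<union> P)) = wz (nths w F) + (\<Sum>p\<in>P. twist w F p)"
proof -
  have fin: "finite F" "finite P" using assms(1,2) finite_subset by blast+
  have PP: "cross_sum w P P = 0"
    unfolding cross_sum_def using commute by (intro sum.neutral ballI) auto
  have "cross_sum w F P = (\<Sum>p\<in>P. \<Sum>q\<in>F. if q < p then cross (w ! q) (w ! p) else 0)"
    unfolding cross_sum_def by (rule sum.swap)
  then have FP: "cross_sum w F P + cross_sum w P F =
      (\<Sum>p\<in>P. \<Sum>q\<in>F. if q < p then cross (w ! q) (w ! p) else cross (w ! p) (w ! q))"
    unfolding cross_sum_def using assms(3)
    by (simp add: sum.distrib[symmetric]) (intro sum.cong; auto)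
  have "cross_sum w (F \<union> P) (F \<union> P) = cross_sum w F F + cross_sum w F P + (cross_sum w P F + cross_sum w P P)"
    unfolding cross_sum_def using fin assms(3) by (simp add: sum.union_disjoint sum.distrib)
  moreover have "(\<Sum>p\<in>F \<union> P. lz (w ! p)) = (\<Sum>p\<in>F. lz (w ! p)) + (\<Sum>p\<in>P. lz (w ! p))"
    using fin assms(3) by (rule sum.union_disjoint)
  ultimately show ?thesis
    using FP PP assms(1,2) by (simp add: wz_nths twist_def sum.distrib)
qed

lemma abs_twist_le:
  assumes "\<forall>l\<in>set w. letter_le K l" "F \<subseteq> {..<length w}" "p < length w" "card F \<le> n"
  shows "\<bar>twist w F p\<bar> \<le> int (K + n * (2 * K * K))"
proof -
  have le: "letter_le K (w ! q)" if "q < length w" for q using assms(1) that by simp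
  have "\<bar>\<Sum>q\<in>F. if q < p then cross (w ! q) (w ! p) else cross (w ! p) (w ! q)\<bar>
      \<le> (\<Sum>q\<in>F. \<bar>if q < p then cross (w ! q) (w ! p) else cross (w ! p) (w ! q)\<bar>)"
    by (rule sum_abs)
  also have "\<dots> \<le> (\<Sum>q\<in>F. int (2 * K * K))"
    using assms(2,3) by (intro sum_mono) (auto intro!: abs_cross_le le simp del: of_nat_mult)
  also have "\<dots> = int (card F * (2 * K * K))" by simp
  also have "\<dots> \<le> int (n * (2 * K * K))"
    unfolding of_nat_le_iff by (rule mult_le_mono1[OF assms(4)])
  finally show ?thesis
    using le[OF assms(3)] unfolding twist_def letter_le_def of_nat_add
    by (intro order_trans[OF abs_triangle_ineq] add_mono) auto
qed

subsection \<open>Pumping modulo an integer\<close>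

text \<open>Two prefixes that agree modulo \<open>D\<close> in all three coordinates enclose a
  factor that is trivial modulo \<open>D\<close>, and so are its cross terms with both sides; there
  are \<open>D ^ 3\<close> residue triples. The factors cut out are collected in \<open>fs\<close>
  because the first two coordinates have to be accounted for exactly.\<close>

lemma pump_modulo:
  fixes D :: int
  assumes "D > 0"
  shows "\<exists>s fs. set s \<union> set (concat fs) \<subseteq> set g \<and> length s \<le> nat D ^ 3 \<and>
    (\<forall>f\<in>set fs. length f \<le> nat D ^ 3 \<and> D dvd wx f \<and> D dvd wy f \<and> D dvd wz f) \<and>
    wx s + wx (concat fs) = wx g \<and> wy s + wy (concat fs) = wy g \<and> D dvd wz g - wz s"
proof (induction "length g" arbitrary: g rule: less_induct)
  case less
  show ?case
  proof (cases "length g \<le> nat D ^ 3")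
    case True
    then show ?thesis by (intro exI[of _ g] exI[of _ "[]"]) simp
  next
    case False
    let ?S = "{0..<D} \<times> {0..<D} \<times> {0..<D}"
    have card: "card ?S = nat D ^ 3" by (simp add: card_cartesian_product power3_eq_cube)
    obtain u v w where uvw: "g = u @ v @ w" "v \<noteq> []" "length v \<le> nat D ^ 3"
      "(wx (u @ v) mod D, wy (u @ v) mod D, wz (u @ v) mod D) = (wx u mod D, wy u mod D, wz u mod D)"
      by (rule prefix_repeat[of ?S g "\<lambda>w. (wx w mod D, wy w mod D, wz w mod D)"])
        (use assms False card in auto)
    have x: "D dvd wx v" and y: "D dvd wy v"
      using uvw(4) by (auto simp: mod_eq_dvd_iff)
    have "D dvd wz v + (wx u * wy v - wy u * wx v)"
      using uvw(4) by (auto simp: mod_eq_dvd_iff algebra_simps)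
    moreover have "D dvd wx u * wy v - wy u * wx v" using x y by (simp add: dvd_diff)
    ultimately have z: "D dvd wz v" using dvd_add_left_iff by blast
    have "length (u @ w) < length g" using uvw(1,2) by simp
    then obtain s fs where s: "set s \<union> set (concat fs) \<subseteq> set (u @ w)" "length s \<le> nat D ^ 3"
      "\<forall>f\<in>set fs. length f \<le> nat D ^ 3 \<and> D dvd wx f \<and> D dvd wy f \<and> D dvd wz f"
      "wx s + wx (concat fs) = wx (u @ w)" "wy s + wy (concat fs) = wy (u @ w)"
      "D dvd wz (u @ w) - wz s"
      using less by blast
    have "wz g - wz s = (wz (u @ w) - wz s) + wz v + (wx u * wy v - wy u * wx v)
        + (wx v * wy w - wy v * wx w)"
      unfolding uvw(1) by (simp add: algebra_simps)
    moreover have "D dvd \<dots>"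
      by (intro dvd_add dvd_diff s(6) z dvd_mult x y dvd_mult2)
    ultimately have "D dvd wz g - wz s" by (simp only:)
    then show ?thesis
      using s x y z uvw(1,3) by (intro exI[of _ s] exI[of _ "v # fs"]) auto
  qed
qed

subsection \<open>Shuffles of two letters\<close>

text \<open>\<open>t\<close> counts the pairs in which a \<open>j\<close> stands before an
  \<open>i\<close>. A further \<open>i\<close> creates none of them when put in front and
  \<open>m\<close> when put at the end.\<close>

lemma shuffle_wz:
  assumes "t \<le> n * m"
  shows "\<exists>w. mset w = replicate_mset n i + replicate_mset m j \<and>
    wz w = int n * lz i + int m * lz j + cross i j * (int (n * m) - 2 * int t)"
  using assms
proof (induction n arbitrary: t)
  case 0
  then show ?case by (intro exI[of _ "replicate m j"]) simp
next
  case (Suc n)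
  have xy: "wx w = int n * lx i + int m * lx j" "wy w = int n * ly i + int m * ly j"
    if "mset w = replicate_mset n i + replicate_mset m j" for w
  proof -
    have "mset w = mset (replicate n i @ replicate m j)" using that by simp
    then have "wx w = wx (replicate n i @ replicate m j)" "wy w = wy (replicate n i @ replicate m j)"
      by (rule wx_mset_eq wy_mset_eq)+
    then show "wx w = int n * lx i + int m * lx j" "wy w = int n * ly i + int m * ly j"
      by simp_all
  qed
  \<comment> \<open>The outer cases leave a gap only for \<open>n = 0\<close>; there the single
    \<open>i\<close> goes behind \<open>t\<close> copies of \<open>j\<close>.\<close>
  consider "t \<le> n * m" | "n = 0" | "m \<le> t" "t - m \<le> n * m"
    using Suc.prems by (cases n) force+
  then show ?case
  proof cases
    case 1
    then obtain w where w: "mset w = replicate_mset n i + replicate_mset m j"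
      "wz w = int n * lz i + int m * lz j + cross i j * (int (n * m) - 2 * int t)"
      using Suc.IH by blast
    show ?thesis
      using w by (intro exI[of _ "i # w"]) (simp add: xy[OF w(1)] cross_def algebra_simps)
  next
    case 2
    have t: "t \<le> m" using 2 Suc.prems by simp
    then have "replicate_mset t j + replicate_mset (m - t) j = replicate_mset m j"
      by (auto simp: multiset_eq_iff)
    then show ?thesis
      using 2 t by (intro exI[of _ "replicate t j @ [i] @ replicate (m - t) j"])
        (auto simp: cross_def algebra_simps of_nat_diff)
  next
    case 3
    then obtain w where w: "mset w = replicate_mset n i + replicate_mset m j"
      "wz w = int n * lz i + int m * lz j + cross i j * (int (n * m) - 2 * int (t - m))"
      using Suc.IH by blast
    show ?thesis
      using w 3 by (intro exI[of _ "w @ [i]"]) (simp add: xy[OF w(1)] cross_def algebra_simps of_nat_diff)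
  qed
qed

subsection \<open>Bounded solutions\<close>

text \<open>A piece has to balance one side against the other, so the letters or factors of both
  sides are pooled in one list over a sum type, those on the right counted negatively.\<close>

primrec lefts :: "('a + 'b) list \<Rightarrow> 'a list" where
  "lefts [] = []"
| "lefts (z # zs) = (case z of Inl x \<Rightarrow> x # lefts zs | Inr _ \<Rightarrow> lefts zs)"

primrec rights :: "('a + 'b) list \<Rightarrow> 'b list" where
  "rights [] = []"
| "rights (z # zs) = (case z of Inl _ \<Rightarrow> rights zs | Inr y \<Rightarrow> y # rights zs)"

lemma set_lefts: "set (lefts zs) = {x. Inl x \<in> set zs}"
  by (induction zs) (auto split: sum.splits)

lemma set_rights: "set (rights zs) = {x. Inr x \<in> set zs}"
  by (induction zs) (auto split: sum.splits)

lemma length_lefts: "length (lefts zs) \<le> length zs"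
  by (induction zs) (auto split: sum.splits)

lemma length_rights: "length (rights zs) \<le> length zs"
  by (induction zs) (auto split: sum.splits)

lemma distinct_lefts: "distinct zs \<Longrightarrow> distinct (lefts zs)"
  by (induction zs) (auto split: sum.splits simp: set_lefts)

lemma distinct_rights: "distinct zs \<Longrightarrow> distinct (rights zs)"
  by (induction zs) (auto split: sum.splits simp: set_rights)

lemma sum_list_case_sum:
  fixes f :: "'a \<Rightarrow> int"
  shows "sum_list (map (case_sum f (\<lambda>y. - h y)) zs) =
    sum_list (map f (lefts zs)) - sum_list (map h (rights zs))"
  by (induction zs) (auto split: sum.splits)

lemma lefts_rights_append [simp]:
  "lefts (map Inl xs @ map Inr ys) = xs" "rights (map Inl xs @ map Inr ys) = ys"
proof -
  have "lefts (map Inr ys) = []" "rights (map Inr ys) = ys" for ys :: "'b list"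
    by (induction ys) auto
  then show "lefts (map Inl xs @ map Inr ys) = xs" "rights (map Inl xs @ map Inr ys) = ys"
    by (induction xs) auto
qed

section \<open>Short solutions modulo an integer\<close>

lemma dvd_sum_list: "(\<And>x. x \<in> set xs \<Longrightarrow> (D::int) dvd f x) \<Longrightarrow> D dvd sum_list (map f xs)"
  by (induction xs) auto

text \<open>The factors in \<open>fs\<close> are trivial modulo \<open>D\<close>, so any selection
  of them may be put back at the end without changing the class of \<open>wz\<close>.\<close>

lemma pump_modulo_after:
  fixes D :: int
  assumes "D > 0"
  obtains s fs where "set s \<union> set (concat fs) \<subseteq> set g" "length s \<le> nat D ^ 3"
    "\<And>f. f \<in> set fs \<Longrightarrow> length f \<le> nat D ^ 3"
    "wx s + wx (concat fs) = wx g" "wy s + wy (concat fs) = wy g"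
    "\<And>fs'. set fs' \<subseteq> set fs \<Longrightarrow> D dvd wz (T # s @ concat fs') - wz (T # g)"
proof -
  obtain s fs where s: "set s \<union> set (concat fs) \<subseteq> set g" "length s \<le> nat D ^ 3"
    and fs: "\<And>f. f \<in> set fs \<Longrightarrow> length f \<le> nat D ^ 3 \<and> D dvd wx f \<and> D dvd wy f \<and> D dvd wz f"
    and xy: "wx s + wx (concat fs) = wx g" "wy s + wy (concat fs) = wy g"
    and z: "D dvd wz g - wz s"
    using pump_modulo[OF assms, of g] by blast
  have x_dvd: "D dvd wx (concat fs')" and y_dvd: "D dvd wy (concat fs')" if "set fs' \<subseteq> set fs" for fs'
    unfolding wx_concat wy_concat using fs that by (auto intro!: dvd_sum_list)
  have z_dvd: "D dvd wz (concat fs')" if "set fs' \<subseteq> set fs" for fs'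
    using that
  proof (induction fs')
    case (Cons f fs')
    then have "D dvd wz f" "D dvd wx f" "D dvd wy f" "D dvd wz (concat fs')" using fs by auto
    then show ?case by simp
  qed simp
  have "D dvd wz (T # s @ concat fs') - wz (T # g)" if "set fs' \<subseteq> set fs" for fs'
  proof -
    note d = x_dvd[OF that] y_dvd[OF that] z_dvd[OF that]
    have *: "wz (T # s @ concat fs') - wz (T # g) = wz (concat fs') - (wz g - wz s)
        + (wx s * wy (concat fs') - wy s * wx (concat fs'))
        + (lx T * (wy (concat fs') - wy (concat fs)) - ly T * (wx (concat fs') - wx (concat fs)))"
      by (simp add: xy[symmetric] algebra_simps)
    show ?thesis
      unfolding *
      by (intro dvd_add[OF dvd_add[OF dvd_diff[OF d(3) z] dvd_diff] dvd_diff] dvd_mult d(1,2)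
          dvd_diff[OF d(1) x_dvd[OF order_refl]] dvd_diff[OF d(2) y_dvd[OF order_refl]])
  qed
  with s fs xy show ?thesis by (intro that[of s fs]) auto
qed

text \<open>For a modulus up to \<open>4 * K * K\<close> the pumped word and the factors cut out
  have length at most \<open>n = (4 * K * K) ^ 3\<close>, hence coordinates up to
  \<open>n * K\<close>. A base letter adds \<open>K\<close>, and comparing two sides doubles
  this.\<close>

definition congruent_bound :: "nat \<Rightarrow> nat" where
  "congruent_bound K = (4 * K * K) ^ 3 +
     (4 * K * K) ^ 3 * zero_sum_bound (2 * (K + (4 * K * K) ^ 3 * K)) 2"

text \<open>Both words are pumped down; a zero-sum split for two functionals then selects boundedly
  many factors to put back so that \<open>wx\<close> and \<open>wy\<close> agree exactly. The class
  of \<open>wz\<close> does not notice the selection.\<close>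

lemma short_congruent_solution:
  fixes D :: int
  assumes le: "\<forall>l\<in>set (T # S # g @ h). letter_le K l"
    and eq: "wx (T # g) = wx (S # h)" "wy (T # g) = wy (S # h)" "wz (T # g) = wz (S # h)"
    and D: "D > 0" "D \<le> int (4 * K * K)"
  obtains g' h' where "set g' \<subseteq> set g" "set h' \<subseteq> set h"
    "wx (T # g') = wx (S # h')" "wy (T # g') = wy (S # h')"
    "D dvd wz (S # h') - wz (T # g')"
    "length g' \<le> congruent_bound K" "length h' \<le> congruent_bound K"
proof -
  define n where "n = (4 * K * K) ^ 3"
  define m where "m = 2 * (K + n * K)"
  have D_n: "nat D ^ 3 \<le> n"
    unfolding n_def using D(2) by (intro power_mono) (simp_all add: nat_le_iff)
  obtain s fs where s: "set s \<union> set (concat fs) \<subseteq> set g" "length s \<le> nat D ^ 3"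
    and fs: "\<And>f. f \<in> set fs \<Longrightarrow> length f \<le> nat D ^ 3"
    and s_xy: "wx s + wx (concat fs) = wx g" "wy s + wy (concat fs) = wy g"
    and s_z: "\<And>fs'. set fs' \<subseteq> set fs \<Longrightarrow> D dvd wz (T # s @ concat fs') - wz (T # g)"
    using pump_modulo_after[OF D(1), of g T] by metis
  obtain s' fs' where s': "set s' \<union> set (concat fs') \<subseteq> set h" "length s' \<le> nat D ^ 3"
    and fs': "\<And>f. f \<in> set fs' \<Longrightarrow> length f \<le> nat D ^ 3"
    and s'_xy: "wx s' + wx (concat fs') = wx h" "wy s' + wy (concat fs') = wy h"
    and s'_z: "\<And>fs''. set fs'' \<subseteq> set fs' \<Longrightarrow> D dvd wz (S # s' @ concat fs'') - wz (S # h)"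
    using pump_modulo_after[OF D(1), of h S] by metis
  note len = s(2)[THEN order_trans, OF D_n] s'(2)[THEN order_trans, OF D_n]
    fs[THEN order_trans, OF _ D_n] fs'[THEN order_trans, OF _ D_n]
  define fx where "fx = case_sum wx (\<lambda>w. - wx w)"
  define fy where "fy = case_sum wy (\<lambda>w. - wy w)"
  define cx where "cx = wx (T # s) - wx (S # s')"
  define cy where "cy = wy (T # s) - wy (S # s')"
  have leT: "letter_le K T" "letter_le K S" using le by auto
  have leg: "\<forall>l\<in>set w. letter_le K l" if "set w \<subseteq> set g \<or> set w \<subseteq> set h" for w
    using le that by auto
  have abs_w: "\<bar>wx w\<bar> \<le> int (n * K)" "\<bar>wy w\<bar> \<le> int (n * K)"
    if "set w \<subseteq> set g \<or> set w \<subseteq> set h" "length w \<le> n" for w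
    using abs_wx_le[OF leg[OF that(1)] that(2)] abs_wy_le[OF leg[OF that(1)] that(2)] by auto
  have bound_f: "\<bar>fx w\<bar> \<le> int m \<and> \<bar>fy w\<bar> \<le> int m" if "w \<in> set (map Inl fs @ map Inr fs')" for w
  proof -
    have "set f \<subseteq> set g \<or> set f \<subseteq> set h" if "f \<in> set fs \<union> set fs'" for f
      using that s(1) s'(1) by auto
    then have "\<bar>wx f\<bar> \<le> int (n * K) \<and> \<bar>wy f\<bar> \<le> int (n * K)" if "f \<in> set fs \<union> set fs'" for f
      using that abs_w len(3,4) by blast
    then have "\<bar>fx w\<bar> \<le> int (n * K) \<and> \<bar>fy w\<bar> \<le> int (n * K)"
      using that by (auto simp: fx_def fy_def simp del: of_nat_mult)
    moreover have "int (n * K) \<le> int m" unfolding m_def of_nat_le_iff by simp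
    ultimately show ?thesis by linarith
  qed
  have bound_c: "\<bar>cx\<bar> \<le> int m \<and> \<bar>cy\<bar> \<le> int m"
  proof -
    have m: "int m = 2 * int K + 2 * int (n * K)" unfolding m_def by simp
    have "set s \<subseteq> set g" "set s' \<subseteq> set h" using s(1) s'(1) by auto
    then have w: "\<bar>wx s\<bar> \<le> int (n * K)" "\<bar>wy s\<bar> \<le> int (n * K)"
      "\<bar>wx s'\<bar> \<le> int (n * K)" "\<bar>wy s'\<bar> \<le> int (n * K)"
      using len(1,2) by (intro abs_w; simp)+
    have l: "\<bar>lx T\<bar> \<le> int K" "\<bar>ly T\<bar> \<le> int K" "\<bar>lx S\<bar> \<le> int K" "\<bar>ly S\<bar> \<le> int K"
      using leT by (simp_all add: letter_le_def)
    have tri: "\<bar>a + b - (c + e)\<bar> \<le> int m"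
      if "\<bar>a\<bar> \<le> int K" "\<bar>b\<bar> \<le> int (n * K)" "\<bar>c\<bar> \<le> int K" "\<bar>e\<bar> \<le> int (n * K)" for a b c e
      using that unfolding m abs_le_iff by linarith
    show ?thesis
      unfolding cx_def cy_def wx.simps wy.simps using w l tri by blast
  qed
  have sum_f: "sum_list (map fx zs) = wx (concat (lefts zs)) - wx (concat (rights zs))"
    "sum_list (map fy zs) = wy (concat (lefts zs)) - wy (concat (rights zs))" for zs
    unfolding fx_def fy_def sum_list_case_sum wx_concat wy_concat by simp_all
  obtain ys xss where ys: "mset (ys @ concat xss) = mset (map Inl fs @ map Inr fs')"
    "length ys < zero_sum_bound m (length [(fx, cx), (fy, cy)])"
    "\<And>f c. (f, c) \<in> set [(fx, cx), (fy, cy)] \<Longrightarrow> c + sum_list (map f ys) = 0"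
  proof (rule zero_sum_split_affine[of "[(fx, cx), (fy, cy)]" "map Inl fs @ map Inr fs'" m])
    fix f c assume "(f, c) \<in> set [(fx, cx), (fy, cy)]"
    moreover have "cx + sum_list (map fx (map Inl fs @ map Inr fs')) = 0"
      "cy + sum_list (map fy (map Inl fs @ map Inr fs')) = 0"
      unfolding sum_f lefts_rights_append using eq(1,2) s_xy s'_xy by (simp_all add: cx_def cy_def)
    ultimately show "(\<forall>x\<in>set (map Inl fs @ map Inr fs'). \<bar>f x\<bar> \<le> int m) \<and> \<bar>c\<bar> \<le> int m \<and>
        c + sum_list (map f (map Inl fs @ map Inr fs')) = 0"
      using bound_f bound_c by auto
  qed blast
  have "set ys \<subseteq> set (map Inl fs @ map Inr fs')"
    using mset_eq_setD[OF ys(1)] by auto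
  then have sub: "set (lefts ys) \<subseteq> set fs" "set (rights ys) \<subseteq> set fs'"
    by (auto simp: set_lefts set_rights)
  let ?g = "s @ concat (lefts ys)" and ?h = "s' @ concat (rights ys)"
  have len_ys: "length (concat (lefts ys)) \<le> n * zero_sum_bound m 2"
    "length (concat (rights ys)) \<le> n * zero_sum_bound m 2"
    using ys(2) length_lefts[of ys] length_rights[of ys] len(3,4) sub
    by (auto intro!: length_concat_le simp: numeral_2_eq_2 simp del: zero_sum_bound.simps)
  show ?thesis
  proof (rule that[of ?g ?h])
    show "set ?g \<subseteq> set g" "set ?h \<subseteq> set h"
      using sub s(1) s'(1) unfolding set_append set_concat by blast+
    show "wx (T # ?g) = wx (S # ?h)" "wy (T # ?g) = wy (S # ?h)"
      using ys(3)[of fx cx] ys(3)[of fy cy] unfolding sum_f by (simp_all add: cx_def cy_def)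
    have "D dvd (wz (S # ?h) - wz (S # h)) - (wz (T # ?g) - wz (T # g))"
      by (intro dvd_diff s_z s'_z sub)
    then show "D dvd wz (S # ?h) - wz (T # ?g)" unfolding eq(3) by (simp only: diff_diff_eq2 diff_add_cancel diff_diff_add add_diff_eq)
    show "length ?g \<le> congruent_bound K" "length ?h \<le> congruent_bound K"
      using len_ys len(1,2) unfolding congruent_bound_def n_def m_def by simp_all
  qed
qed

text \<open>What the shuffle below has to compensate: the drift in \<open>wz\<close> from exchanging
  one balanced word for the other, and the defect of the congruent solution, whose words carry a
  base letter, whence the \<open>+ 1\<close>.\<close>

definition deviation_bound :: "nat \<Rightarrow> nat \<Rightarrow> nat" where
  "deviation_bound K M = 2 * wz_bound K M + 2 * K + 2 * wz_bound K (congruent_bound K + 1)"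

definition noncommuting_bound :: "nat \<Rightarrow> nat \<Rightarrow> nat" where
  "noncommuting_bound K M = congruent_bound K + 2 * (2 * K * K * deviation_bound K M) * M"

text \<open>
  Appending \<open>r\<^sup>N\<close>, a shuffle of \<open>i\<^sup>2\<^sup>N\<close> and \<open>j\<^sup>2\<^sup>N\<close>, and \<open>r\<^sup>N\<close> on the left and \<open>q\<^sup>2\<^sup>N\<close> on the right
  preserves the equality of the first two coordinates. The symmetric placement of \<open>r\<^sup>N\<close> makes the
  cross terms cancel, so the remaining difference in \<^const>\<open>wz\<close> is linear in \<open>N\<close>, while the shuffle
  ranges over a progression of quadratic length.
\<close>

lemma short_solution_noncommuting:
  assumes le: "\<forall>l\<in>set (T # S # g @ h). letter_le K l"
    and eq: "wx (T # g) = wx (S # h)" "wy (T # g) = wy (S # h)" "wz (T # g) = wz (S # h)"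
    and pq: "set p \<subseteq> set g" "set q \<subseteq> set h" "wx p = wx q" "wy p = wy q"
      "length p \<le> M" "length q \<le> M"
    and p: "mset p = mset (i # j # r)" "cross i j \<noteq> 0"
  shows "\<exists>g' h'. set g' \<subseteq> set g \<and> set h' \<subseteq> set h \<and>
    wx (T # g') = wx (S # h') \<and> wy (T # g') = wy (S # h') \<and> wz (T # g') = wz (S # h') \<and>
    length g' \<le> noncommuting_bound K M \<and> length h' \<le> noncommuting_bound K M"
proof -
  define d where "d = cross i j"
  have set_p: "set (i # j # r) = set p" using mset_eq_setD[OF p(1)] by simp
  have leij: "letter_le K i" "letter_le K j" using set_p pq(1) le by auto
  have d: "\<bar>d\<bar> \<le> int (2 * K * K)" "d \<noteq> 0" using abs_cross_le[OF leij] p(2) by (auto simp: d_def)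
  have D: "2 * \<bar>d\<bar> > 0" "2 * \<bar>d\<bar> \<le> int (4 * K * K)" using d by auto
  obtain u v where uv: "set u \<subseteq> set g" "set v \<subseteq> set h"
    "wx (T # u) = wx (S # v)" "wy (T # u) = wy (S # v)"
    "2 * \<bar>d\<bar> dvd wz (S # v) - wz (T # u)"
    "length u \<le> congruent_bound K" "length v \<le> congruent_bound K"
    using short_congruent_solution[OF le eq D] by blast
  define \<delta> where "\<delta> = wz (S # v) - wz (T # u)"
  \<comment> \<open>Cross terms aside, using \<open>i\<close>, \<open>j\<close>, \<open>r\<close>
    against \<open>q\<close> loses \<open>e\<close> in \<open>wz\<close>. Over \<open>2 * N\<close>
    copies the shuffle must supply \<open>2 * N * e + \<delta>\<close>.\<close>
  define e where "e = wz q - wz r - lz i - lz j"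
  define N\<^sub>0 where "N\<^sub>0 = nat (\<bar>e\<bar> + \<bar>\<delta>\<bar>)"
  \<comment> \<open>The factor \<open>nat \<bar>d\<bar>\<close> makes \<open>2 * N * e\<close>
    divisible by \<open>2 * d\<close>; the factor \<open>N\<^sub>0\<close> makes the quadratic range
    large enough for \<open>e\<close> and \<open>\<delta>\<close>.\<close>
  define N where "N = nat \<bar>d\<bar> * N\<^sub>0"
  have "2 * d dvd \<delta>" using uv(5) by (simp add: \<delta>_def abs_mult[symmetric] dvd_abs_iff) (metis abs_dvd_iff abs_mult abs_numeral)
  then obtain k where k: "\<delta> = 2 * d * k" by blast
  define m where "m = sgn d * int N\<^sub>0 * e + k"
  have dm: "2 * int N * e + \<delta> = 2 * d * m"
  proof -
    have "int N = \<bar>d\<bar> * int N\<^sub>0" by (simp add: N_def)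
    also have "\<bar>d\<bar> = d * sgn d" by (simp add: abs_sgn mult.commute)
    finally show ?thesis by (simp add: k m_def algebra_simps)
  qed
  \<comment> \<open>Shuffling \<open>2 * N\<close> copies of each letter supplies
    \<open>2 * d * m\<close> for every \<open>m\<close> in this range, with
    \<open>t = 2 * N * N - m\<close>.\<close>
  have "\<bar>m\<bar> \<le> 2 * (int N * int N)"
  proof -
    have d1: "1 \<le> \<bar>d\<bar>" using d(2) by simp
    have "\<bar>k\<bar> \<le> \<bar>\<delta>\<bar>"
      unfolding k abs_mult using d1 mult_mono[of 1 "2 * \<bar>d\<bar>" "\<bar>k\<bar>" "\<bar>k\<bar>"] by simp
    moreover have "int N\<^sub>0 = \<bar>e\<bar> + \<bar>\<delta>\<bar>" by (simp add: N\<^sub>0_def)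
    ultimately have ek: "\<bar>e\<bar> \<le> int N\<^sub>0" "\<bar>k\<bar> \<le> int N\<^sub>0" by auto
    have "\<bar>m\<bar> \<le> \<bar>sgn d * int N\<^sub>0 * e\<bar> + \<bar>k\<bar>" unfolding m_def by (rule abs_triangle_ineq)
    also have "\<dots> = int N\<^sub>0 * \<bar>e\<bar> + \<bar>k\<bar>" using d(2) by (simp add: abs_mult)
    also have "\<dots> \<le> int N\<^sub>0 * int N\<^sub>0 + int N\<^sub>0 * int N\<^sub>0"
    proof -
      have "int N\<^sub>0 * \<bar>e\<bar> \<le> int N\<^sub>0 * int N\<^sub>0" using ek(1) by (simp add: mult_left_mono)
      moreover have "int N\<^sub>0 \<le> int N\<^sub>0 * int N\<^sub>0" by (cases N\<^sub>0) auto
      ultimately show ?thesis using ek(2) by linarith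
    qed
    also have "\<dots> \<le> 2 * (int N * int N)"
    proof -
      have "int N\<^sub>0 \<le> int N" unfolding N_def using d1 by (cases "nat \<bar>d\<bar>") auto
      then have "int N\<^sub>0 * int N\<^sub>0 \<le> int N * int N" by (intro mult_mono) auto
      then show ?thesis by simp
    qed
    finally show ?thesis .
  qed
  then have t: "0 \<le> 2 * (int N * int N) - m" "2 * (int N * int N) - m \<le> int ((2 * N) * (2 * N))" by auto
  define t where "t = nat (2 * (int N * int N) - m)"
  have "t \<le> (2 * N) * (2 * N)" using t(2) by (simp add: t_def nat_le_iff)
  then obtain w where w: "mset w = replicate_mset (2 * N) i + replicate_mset (2 * N) j"
    "wz w = int (2 * N) * lz i + int (2 * N) * lz j + d * (int ((2 * N) * (2 * N)) - 2 * int t)"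
    using shuffle_wz unfolding d_def by blast
  have int_t: "int t = 2 * (int N * int N) - m" using t(1) by (simp add: t_def)
  have wz_w: "wz w = 2 * int N * (lz i + lz j) + 2 * d * m"
    unfolding w(2) int_t by (simp add: algebra_simps)
  have mset_w: "mset w = mset (replicate (2 * N) i @ replicate (2 * N) j)" using w(1) by simp
  have w_xy: "wx w = 2 * int N * (lx i + lx j)" "wy w = 2 * int N * (ly i + ly j)"
    using wx_mset_eq[OF mset_w] wy_mset_eq[OF mset_w] by (simp_all add: algebra_simps)
  have set_w: "set w \<subseteq> {i, j}" using mset_eq_setD[OF mset_w] by auto
  have len_w: "length w = 4 * N" using mset_eq_length[OF mset_w] by simp
  define R where "R = concat (replicate N r)"
  define U where "U = R @ w @ R"
  define V where "V = concat (replicate (2 * N) q)"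
  have p_xy: "wx q = lx i + lx j + wx r" "wy q = ly i + ly j + wy r"
    using wx_mset_eq[OF p(1)] wy_mset_eq[OF p(1)] pq(3,4) by simp_all
  have UV: "wx U = wx V" "wy U = wy V"
    unfolding U_def V_def R_def by (simp_all add: w_xy p_xy algebra_simps)
  have "wz U = 2 * int N * wz r + wz w"
    unfolding U_def R_def by (simp add: algebra_simps)
  then have "wz U = wz V + \<delta>"
    using dm unfolding wz_w V_def e_def by (simp add: algebra_simps)
  \<comment> \<open>The prefixes agree in the first two coordinates, and so do the suffixes; hence
    the cross terms are equal on both sides, and the two occurrences of \<open>\<delta>\<close>
    cancel.\<close>
  then have z: "wz (T # u @ U) = wz (S # v @ V)"
    using uv(3,4) UV wz_append[of "T # u" U] wz_append[of "S # v" V] unfolding \<delta>_def by simp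
  have N_le: "N \<le> 2 * K * K * deviation_bound K M"
  proof -
    have "\<bar>wz q\<bar> \<le> int (wz_bound K M)" using le pq(2,6) by (intro abs_wz_le) auto
    moreover have "\<bar>wz r\<bar> \<le> int (wz_bound K M)"
      using le pq(1,5) set_p mset_eq_length[OF p(1)] by (intro abs_wz_le) auto
    moreover have "\<bar>lz i\<bar> \<le> int K" "\<bar>lz j\<bar> \<le> int K" using leij by (auto simp: letter_le_def)
    moreover have "\<bar>wz (S # v)\<bar> \<le> int (wz_bound K (congruent_bound K + 1))"
      using le uv by (intro abs_wz_le) auto
    moreover have "\<bar>wz (T # u)\<bar> \<le> int (wz_bound K (congruent_bound K + 1))"
      using le uv by (intro abs_wz_le) auto
    ultimately have "\<bar>e\<bar> + \<bar>\<delta>\<bar> \<le> int (deviation_bound K M)"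
      unfolding e_def \<delta>_def deviation_bound_def of_nat_add of_nat_mult by simp
    then have "N\<^sub>0 \<le> deviation_bound K M" unfolding N\<^sub>0_def by simp
    moreover have "nat \<bar>d\<bar> \<le> 2 * K * K" using d(1) by (simp add: nat_le_iff)
    ultimately show ?thesis unfolding N_def by (rule mult_le_mono[rotated])
  qed
  have "length U = 2 * N * length p"
    unfolding U_def R_def using len_w mset_eq_length[OF p(1)]
    by (simp add: length_concat sum_list_replicate algebra_simps)
  also have "\<dots> \<le> 2 * (2 * K * K * deviation_bound K M) * M"
    using N_le pq(5) by (intro mult_le_mono) auto
  finally have len_U: "length U \<le> 2 * (2 * K * K * deviation_bound K M) * M" .
  have "length V = 2 * N * length q"
    unfolding V_def by (simp add: length_concat sum_list_replicate)
  also have "\<dots> \<le> 2 * (2 * K * K * deviation_bound K M) * M"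
    using N_le pq(6) by (intro mult_le_mono) auto
  finally have len_V: "length V \<le> 2 * (2 * K * K * deviation_bound K M) * M" .
  show ?thesis
  proof (rule exI[of _ "u @ U"], rule exI[of _ "v @ V"], intro conjI)
    show "set (u @ U) \<subseteq> set g"
      using uv(1) pq(1) set_p set_w unfolding U_def R_def by auto
    show "set (v @ V) \<subseteq> set h"
      using uv(2) pq(2) unfolding V_def by auto
    show "wx (T # u @ U) = wx (S # v @ V)" "wy (T # u @ U) = wy (S # v @ V)"
      using uv(3,4) UV by simp_all
    show "length (u @ U) \<le> noncommuting_bound K M" "length (v @ V) \<le> noncommuting_bound K M"
      using uv(6,7) len_U len_V unfolding noncommuting_bound_def by simp_all
  qed (rule z)
qed

text \<open>\<open>b\<close> bounds the base piece and every balanced piece; \<open>2 * K\<close>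
  bounds the difference of the base letters. The second summand covers the commuting case, with
  \<open>wz\<close> as a third functional. Two noncommuting letters lie in at most two pieces,
  whence \<open>2 * b\<close>. The sum stands in for a maximum over the cases.\<close>

definition word_bound :: "nat \<Rightarrow> nat" where
  "word_bound K = (let b = zero_sum_bound (2 * K) 2 in
     b + zero_sum_bound (2 * wz_bound K b + K + b * (2 * K * K)) 3 + noncommuting_bound K (2 * b))"

lemma mset_two_elements:
  assumes "p \<in> set xs" "q \<in> set xs" "p \<noteq> q"
  obtains r where "mset xs = mset (p # q # r)"
proof
  have "mset ys = mset (x # remove1 x ys)" if "x \<in> set ys" for x and ys :: "'a list"
    using that by simp
  moreover have "q \<in> set (remove1 p xs)" using assms by (simp add: in_set_remove1)
  ultimately show "mset xs = mset (p # q # remove1 q (remove1 p xs))"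
    using assms(1) by (metis mset.simps(2))
qed

lemma wx_map_nth: "wx (map ((!) w) ps) = sum_list (map (\<lambda>p. lx (w ! p)) ps)"
  by (induction ps) auto

lemma wy_map_nth: "wy (map ((!) w) ps) = sum_list (map (\<lambda>p. ly (w ! p)) ps)"
  by (induction ps) auto

lemma length_nths_le:
  assumes "A \<subseteq> {..<length w}"
  shows "length (nths w A) \<le> card A"
proof -
  have "{i. i < length w \<and> i \<in> A} = A" using assms by auto
  then show ?thesis by (simp add: length_nths)
qed

lemma sum_set_distinct: "distinct xs \<Longrightarrow> (\<Sum>x\<in>set xs. f x) = sum_list (map f xs)"
  by (simp add: sum_list_distinct_conv_sum_set)

theorem short_solution:
  assumes le: "\<forall>l\<in>set (T # S # g @ h). letter_le K l"
    and eq: "wx (T # g) = wx (S # h)" "wy (T # g) = wy (S # h)" "wz (T # g) = wz (S # h)"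
  shows "\<exists>g' h'. set g' \<subseteq> set g \<and> set h' \<subseteq> set h \<and>
    wx (T # g') = wx (S # h') \<and> wy (T # g') = wy (S # h') \<and> wz (T # g') = wz (S # h') \<and>
    length g' \<le> word_bound K \<and> length h' \<le> word_bound K"
proof -
  define G where "G = T # g"
  define H where "H = S # h"
  define b where "b = zero_sum_bound (2 * K) 2"
  have leG: "\<forall>l\<in>set G. letter_le K l" and leH: "\<forall>l\<in>set H. letter_le K l"
    using le unfolding G_def H_def by auto
  have le_nth: "p < length G \<Longrightarrow> letter_le K (G ! p)" "q < length H \<Longrightarrow> letter_le K (H ! q)" for p q
    using leG leH by auto
  \<comment> \<open>Positions start at 1: position 0 holds the base letter, which is never
    dropped.\<close>
  define xs :: "(nat + nat) list" where
    "xs = map Inl [1..<length G] @ map Inr [1..<length H]"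
  have dist_xs: "distinct xs" unfolding xs_def by (auto simp: distinct_map)
  define fx where "fx = case_sum (\<lambda>p. lx (G ! p)) (\<lambda>q. - lx (H ! q))"
  define fy where "fy = case_sum (\<lambda>p. ly (G ! p)) (\<lambda>q. - ly (H ! q))"
  have sum_fx: "sum_list (map fx zs) = wx (map ((!) G) (lefts zs)) - wx (map ((!) H) (rights zs))"
    and sum_fy: "sum_list (map fy zs) = wy (map ((!) G) (lefts zs)) - wy (map ((!) H) (rights zs))" for zs
    unfolding fx_def fy_def sum_list_case_sum wx_map_nth wy_map_nth by simp_all
  have map_tail: "map ((!) (l # w)) [1..<length (l # w)] = w" for l and w :: "letter list"
    by (rule nth_equalityI) (auto simp del: upt_Suc)
  have f_le: "\<bar>fx x\<bar> \<le> int K \<and> \<bar>fy x\<bar> \<le> int K" if "x \<in> set xs" for x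
    using that le_nth unfolding xs_def fx_def fy_def letter_le_def by auto
  have c_le: "\<bar>lx T - lx S\<bar> \<le> int (2 * K) \<and> \<bar>ly T - ly S\<bar> \<le> int (2 * K)"
    using le unfolding letter_le_def by auto
  let ?fcs = "[(fx, lx T - lx S), (fy, ly T - ly S)]"
  obtain ys xss where ms: "mset (ys @ concat xss) = mset xs"
    and len_ys: "length ys < zero_sum_bound (2 * K) (length ?fcs)"
    and sum_ys: "\<And>f c. (f, c) \<in> set ?fcs \<Longrightarrow> c + sum_list (map f ys) = 0"
    and len_xss: "\<And>zs. zs \<in> set xss \<Longrightarrow> length zs \<le> zero_sum_bound (2 * K) (length ?fcs)"
    and sum_xss: "\<And>f c zs. (f, c) \<in> set ?fcs \<Longrightarrow> zs \<in> set xss \<Longrightarrow> sum_list (map f zs) = 0"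
  proof (rule zero_sum_split_affine[of ?fcs xs "2 * K"])
    have "lx T - lx S + sum_list (map fx xs) = 0" "ly T - ly S + sum_list (map fy xs) = 0"
      unfolding sum_fx sum_fy xs_def lefts_rights_append G_def H_def map_tail
      using eq(1,2) by simp_all
    then show "(\<forall>x\<in>set xs. \<bar>f x\<bar> \<le> int (2 * K)) \<and> \<bar>c\<bar> \<le> int (2 * K) \<and> c + sum_list (map f xs) = 0"
      if "(f, c) \<in> set ?fcs" for f c
      using that f_le c_le by fastforce
  qed blast
  have "length ?fcs = 2" by simp
  note len_ys = len_ys[unfolded this, folded b_def] and len_xss = len_xss[unfolded this, folded b_def]
  have sum_ys: "lx T - lx S + sum_list (map fx ys) = 0" "ly T - ly S + sum_list (map fy ys) = 0"
    by (auto intro: sum_ys)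
  have sum_xss: "sum_list (map fx zs) = 0" "sum_list (map fy zs) = 0" if "zs \<in> set xss" for zs
    using that by (auto intro: sum_xss)
  let ?rest = "concat xss"
  have dist: "distinct (ys @ ?rest)"
    using dist_xs mset_eq_imp_distinct_iff[OF ms] by simp
  have sets: "set (ys @ ?rest) = set xs" using mset_eq_setD[OF ms] .
  \<comment> \<open>\<open>P\<close> and \<open>Q\<close> are the positions in balanced pieces,
    which may be dropped; \<open>F\<close> and \<open>E\<close> are kept in the commuting
    case.\<close>
  define P where "P = set (lefts ?rest)"
  define Q where "Q = set (rights ?rest)"
  define F where "F = insert 0 (set (lefts ys))"
  define E where "E = insert 0 (set (rights ys))"
  have in_xs: "Inl p \<in> set xs \<longleftrightarrow> 1 \<le> p \<and> p < length G" "Inr q \<in> set xs \<longleftrightarrow> 1 \<le> q \<and> q < length H" for p q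
    unfolding xs_def by auto
  have P_iff: "p \<in> P \<longleftrightarrow> Inl p \<in> set ?rest" and Q_iff: "p \<in> Q \<longleftrightarrow> Inr p \<in> set ?rest" for p
    unfolding P_def Q_def by (simp_all add: set_lefts set_rights)
  have F_iff: "p \<in> F \<longleftrightarrow> p = 0 \<or> Inl p \<in> set ys" and E_iff: "p \<in> E \<longleftrightarrow> p = 0 \<or> Inr p \<in> set ys" for p
    unfolding F_def E_def by (simp_all add: set_lefts set_rights)
  have lenGH: "0 < length G" "0 < length H" by (simp_all add: G_def H_def)
  have cases_xs: "x \<in> set xs \<longleftrightarrow> x \<in> set ys \<or> x \<in> set ?rest" for x
    using sets by auto
  have P_pos: "1 \<le> p \<and> p < length G" if "p \<in> P" for p
    using that in_xs(1) cases_xs[of "Inl p"] P_iff by blast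
  have Q_pos: "1 \<le> q \<and> q < length H" if "q \<in> Q" for q
    using that in_xs(2) cases_xs[of "Inr q"] Q_iff by blast
  have P: "F \<union> P = {..<length G}" "F \<inter> P = {}"
  proof -
    show "F \<union> P = {..<length G}"
    proof (rule set_eqI)
      fix p
      have "p \<in> F \<union> P \<longleftrightarrow> p = 0 \<or> Inl p \<in> set xs"
        using cases_xs[of "Inl p"] P_iff F_iff by blast
      also have "\<dots> \<longleftrightarrow> p \<in> {..<length G}"
        unfolding in_xs(1) lessThan_iff using lenGH(1) by arith
      finally show "p \<in> F \<union> P \<longleftrightarrow> p \<in> {..<length G}" .
    qed
    have "set ys \<inter> set ?rest = {}" using dist by simp
    then show "F \<inter> P = {}" using P_pos[of 0] P_iff F_iff by fastforce
  qed
  have Q: "E \<union> Q = {..<length H}" "E \<inter> Q = {}"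
  proof -
    show "E \<union> Q = {..<length H}"
    proof (rule set_eqI)
      fix q
      have "q \<in> E \<union> Q \<longleftrightarrow> q = 0 \<or> Inr q \<in> set xs"
        using cases_xs[of "Inr q"] Q_iff E_iff by blast
      also have "\<dots> \<longleftrightarrow> q \<in> {..<length H}"
        unfolding in_xs(2) lessThan_iff using lenGH(2) by arith
      finally show "q \<in> E \<union> Q \<longleftrightarrow> q \<in> {..<length H}" .
    qed
    have "set ys \<inter> set ?rest = {}" using dist by simp
    then show "E \<inter> Q = {}" using Q_pos[of 0] Q_iff E_iff by fastforce
  qed
  have tail_nth: "G ! p \<in> set g" if "p \<in> P" for p
    using P_pos[OF that] by (cases p) (auto simp: G_def)
  have tail_nth': "H ! p \<in> set h" if "p \<in> Q" for p
    using Q_pos[OF that] by (cases p) (auto simp: H_def)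
  \<comment> \<open>If both positions lie in one piece, that piece may be used twice: the
    noncommuting case only needs words over the given letters, so repeated positions do no
    harm.\<close>
  have join: "\<exists>zs. x \<in> set zs \<and> y \<in> set zs \<and> set zs \<subseteq> set ?rest \<and> length zs \<le> 2 * b \<and>
      sum_list (map fx zs) = 0 \<and> sum_list (map fy zs) = 0"
    if xy: "x \<in> set ?rest" "y \<in> set ?rest" for x y
  proof -
    obtain zs zs' where "zs \<in> set xss" "x \<in> set zs" "zs' \<in> set xss" "y \<in> set zs'" using xy by auto
    with len_xss[of zs] len_xss[of zs'] sum_xss show ?thesis
      by (intro exI[of _ "zs @ zs'"]) auto
  qed
  have lr_sub: "set (lefts zs) \<subseteq> P" "set (rights zs) \<subseteq> Q" if "set zs \<subseteq> set ?rest" for zs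
    unfolding set_lefts set_rights using that P_iff Q_iff by blast+
  have piece: "set (map ((!) G) (lefts zs)) \<subseteq> set g" "set (map ((!) H) (rights zs)) \<subseteq> set h"
    if "set zs \<subseteq> set ?rest" for zs
    unfolding set_map using lr_sub[OF that] tail_nth tail_nth' by blast+
  have piece_len: "length (map ((!) G) (lefts zs)) \<le> 2 * b" "length (map ((!) H) (rights zs)) \<le> 2 * b"
    if "length zs \<le> 2 * b" for zs
    using that length_lefts[of zs] length_rights[of zs] by simp_all
  have bound: "b + zero_sum_bound (2 * wz_bound K b + K + b * (2 * K * K)) 3 \<le> word_bound K"
    "noncommuting_bound K (2 * b) \<le> word_bound K"
    unfolding word_bound_def b_def Let_def by simp_all
  consider (left) p p' where "p \<in> P" "p' \<in> P" "cross (G ! p) (G ! p') \<noteq> 0"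
    | (right) q q' where "q \<in> Q" "q' \<in> Q" "cross (H ! q) (H ! q') \<noteq> 0"
    | (commute) "\<And>p p'. p \<in> P \<Longrightarrow> p' \<in> P \<Longrightarrow> cross (G ! p) (G ! p') = 0"
      "\<And>q q'. q \<in> Q \<Longrightarrow> q' \<in> Q \<Longrightarrow> cross (H ! q) (H ! q') = 0"
    by blast
  then show ?thesis
  proof cases
    case left
    then have "p \<noteq> p'" by (auto simp: cross_def)
    obtain zs where zs: "Inl p \<in> set zs" "Inl p' \<in> set zs" "set zs \<subseteq> set ?rest" "length zs \<le> 2 * b"
      "sum_list (map fx zs) = 0" "sum_list (map fy zs) = 0"
      using join[of "Inl p" "Inl p'"] left by (auto simp: P_iff)
    obtain r where "mset (lefts zs) = mset (p # p' # r)"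
      by (rule mset_two_elements[of p "lefts zs" p']) (use zs \<open>p \<noteq> p'\<close> in \<open>auto simp: set_lefts\<close>)
    then have "mset (map ((!) G) (lefts zs)) = mset (G ! p # G ! p' # map ((!) G) r)"
      by (metis list.map(2) mset_map)
    from short_solution_noncommuting[OF le eq piece[OF zs(3)] _ _ piece_len[OF zs(4)] this left(3)]
    obtain g' h' where "set g' \<subseteq> set g" "set h' \<subseteq> set h" "wx (T # g') = wx (S # h')"
      "wy (T # g') = wy (S # h')" "wz (T # g') = wz (S # h')"
      "length g' \<le> noncommuting_bound K (2 * b)" "length h' \<le> noncommuting_bound K (2 * b)"
      using zs(5,6) unfolding sum_fx sum_fy by auto
    moreover from this bound(2) have "length g' \<le> word_bound K" "length h' \<le> word_bound K"
      by linarith+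
    ultimately show ?thesis by blast
  next
    case right
    then have "q \<noteq> q'" by (auto simp: cross_def)
    obtain zs where zs: "Inr q \<in> set zs" "Inr q' \<in> set zs" "set zs \<subseteq> set ?rest" "length zs \<le> 2 * b"
      "sum_list (map fx zs) = 0" "sum_list (map fy zs) = 0"
      using join[of "Inr q" "Inr q'"] right by (auto simp: Q_iff)
    obtain r where "mset (rights zs) = mset (q # q' # r)"
      by (rule mset_two_elements[of q "rights zs" q']) (use zs \<open>q \<noteq> q'\<close> in \<open>auto simp: set_rights\<close>)
    then have ms': "mset (map ((!) H) (rights zs)) = mset (H ! q # H ! q' # map ((!) H) r)"
      by (metis list.map(2) mset_map)
    \<comment> \<open>The problem is symmetric under exchanging the two sides.\<close>
    have le': "\<forall>l\<in>set (S # T # h @ g). letter_le K l" using le by auto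
    from short_solution_noncommuting[OF le' eq[symmetric] piece(2)[OF zs(3)] piece(1)[OF zs(3)] _ _
        piece_len(2)[OF zs(4)] piece_len(1)[OF zs(4)] ms' right(3)]
    obtain h' g' where sol: "set g' \<subseteq> set g" "set h' \<subseteq> set h" "wx (S # h') = wx (T # g')"
      "wy (S # h') = wy (T # g')" "wz (S # h') = wz (T # g')"
      "length g' \<le> noncommuting_bound K (2 * b)" "length h' \<le> noncommuting_bound K (2 * b)"
      using zs(5,6) unfolding sum_fx sum_fy by auto
    show ?thesis
      by (rule exI[of _ g'], rule exI[of _ h'], intro conjI sol(1,2) sol(3-5)[symmetric]
          order_trans[OF sol(6) bound(2)] order_trans[OF sol(7) bound(2)])
  next
    case commute
    define m where "m = 2 * wz_bound K b + K + b * (2 * K * K)"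
    have m_ge: "int K \<le> int m" "int (2 * wz_bound K b) \<le> int m" "int (K + b * (2 * K * K)) \<le> int m"
      unfolding m_def of_nat_le_iff by simp_all
    \<comment> \<open>With \<open>F\<close> and \<open>E\<close> kept in place, the difference in
      \<open>wz\<close> is affine in the other positions, so it becomes a third functional with
      constant \<open>cz\<close>.\<close>
    define fz where "fz = case_sum (twist G F) (\<lambda>q. - twist H E q)"
    define cz where "cz = wz (nths G F) - wz (nths H E)"
    have subs: "F \<subseteq> {..<length G}" "P \<subseteq> {..<length G}" "E \<subseteq> {..<length H}" "Q \<subseteq> {..<length H}"
      unfolding P(1)[symmetric] Q(1)[symmetric] by blast+
    \<comment> \<open>The strict bound on \<open>length ys\<close> absorbs the additional position
      0.\<close>
    have card_FE: "card F \<le> b" "card E \<le> b"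
      using len_ys length_lefts[of ys] length_rights[of ys] card_length[of "lefts ys"] card_length[of "rights ys"]
      unfolding F_def E_def by (simp_all add: card_insert_if)
    have fz_le: "\<bar>fz x\<bar> \<le> int m" if "x \<in> set ?rest" for x
    proof -
      have "\<bar>fz x\<bar> \<le> int (K + b * (2 * K * K))"
      proof (cases x)
        case (Inl p)
        then have "p < length G" using that P(1) P_iff by blast
        then show ?thesis unfolding fz_def Inl sum.case by (rule abs_twist_le[OF leG subs(1) _ card_FE(1)])
      next
        case (Inr q)
        then have "q < length H" using that Q(1) Q_iff by blast
        then show ?thesis unfolding fz_def Inr sum.case abs_minus_cancel
          by (rule abs_twist_le[OF leH subs(3) _ card_FE(2)])
      qed
      then show ?thesis using m_ge(3) by linarith
    qed
    have "\<bar>wz (nths G F)\<bar> \<le> int (wz_bound K b)" "\<bar>wz (nths H E)\<bar> \<le> int (wz_bound K b)"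
      using leG leH card_FE length_nths_le[OF subs(1)] length_nths_le[OF subs(3)]
      by (auto intro!: abs_wz_le dest: in_set_nthsD)
    then have cz_le: "\<bar>cz\<bar> \<le> int m" unfolding cz_def using m_ge(2) by simp
    have sum_fz: "cz + sum_list (map fz zs) =
        wz (nths G (F \<union> set (lefts zs))) - wz (nths H (E \<union> set (rights zs)))"
      if "distinct zs" "set zs \<subseteq> set ?rest" for zs
    proof -
      have sub: "set (lefts zs) \<subseteq> P" "set (rights zs) \<subseteq> Q"
        using that(2) by (rule lr_sub)+
      have "wz (nths G (F \<union> set (lefts zs))) = wz (nths G F) + (\<Sum>p\<in>set (lefts zs). twist G F p)"
        by (rule wz_nths_Un[OF subs(1)]) (use sub(1) subs(2) P(2) commute(1) in blast)+
      moreover have "wz (nths H (E \<union> set (rights zs))) = wz (nths H E) + (\<Sum>q\<in>set (rights zs). twist H E q)"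
        by (rule wz_nths_Un[OF subs(3)]) (use sub(2) subs(4) Q(2) commute(2) in blast)+
      ultimately show ?thesis
        unfolding cz_def fz_def sum_list_case_sum
        using that(1) by (simp add: sum_set_distinct distinct_lefts distinct_rights)
    qed
    have dist_rest: "distinct ?rest" using dist by simp
    \<comment> \<open>In the first two coordinates the kept positions are already balanced, hence
      the constants 0.\<close>
    let ?gcs = "[(fx, 0), (fy, 0), (fz, cz)]"
    obtain us uss where us: "mset (us @ concat uss) = mset ?rest"
      and len_us: "length us < zero_sum_bound m (length ?gcs)"
      and sum_us: "\<And>f c. (f, c) \<in> set ?gcs \<Longrightarrow> c + sum_list (map f us) = 0"
    proof (rule zero_sum_split_affine[of ?gcs ?rest m])
      fix f c assume fc: "(f, c) \<in> set ?gcs"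
      have "wz (nths G (F \<union> P)) = wz (nths H (E \<union> Q))"
        unfolding P(1) Q(1) using eq(3) by (simp add: nths_all G_def H_def)
      then have sums: "cz + sum_list (map fz ?rest) = 0"
        unfolding sum_fz[OF dist_rest order_refl] P_def Q_def by simp
      have sums': "sum_list (map fx ?rest) = 0" "sum_list (map fy ?rest) = 0"
        unfolding sum_list_map_concat by (simp_all add: sum_xss cong: map_cong)
      have fxy_le: "\<bar>fx x\<bar> \<le> int m \<and> \<bar>fy x\<bar> \<le> int m" if "x \<in> set ?rest" for x
      proof -
        have "x \<in> set xs" using that cases_xs by blast
        from f_le[OF this] show ?thesis using m_ge(1) by linarith
      qed
      from fc consider "f = fx" "c = 0" | "f = fy" "c = 0" | "f = fz" "c = cz" by auto
      then show "(\<forall>x\<in>set ?rest. \<bar>f x\<bar> \<le> int m) \<and> \<bar>c\<bar> \<le> int m \<and> c + sum_list (map f ?rest) = 0"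
        by cases (use sums sums' fxy_le fz_le cz_le in \<open>simp_all del: set_concat\<close>)
    qed blast
    have "length ?gcs = 3" by simp
    note len_us = len_us[unfolded this]
    have sum_us: "0 + sum_list (map fx us) = 0" "0 + sum_list (map fy us) = 0" "cz + sum_list (map fz us) = 0"
      by (rule sum_us; simp)+
    have sub: "set us \<subseteq> set ?rest" using mset_eq_setD[OF us] unfolding set_append by blast
    have dist_us: "distinct us" using mset_eq_imp_distinct_iff[OF us] dist_rest by simp
    define A where "A = F \<union> set (lefts us)"
    define B where "B = E \<union> set (rights us)"
    have lr: "set (lefts us) \<subseteq> P" "set (rights us) \<subseteq> Q"
      using sub by (rule lr_sub)+
    have AB: "A \<subseteq> {..<length G}" "B \<subseteq> {..<length H}"
      unfolding A_def B_def using lr subs by blast+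
    have z: "wz (nths G A) = wz (nths H B)"
      using sum_fz[OF dist_us sub] sum_us(3) unfolding A_def B_def by simp
    have fin: "finite F" "finite E" unfolding F_def E_def by auto
    have dist_ys: "distinct (lefts ys)" "distinct (rights ys)"
      using dist distinct_lefts distinct_rights by auto
    have zero: "0 \<notin> set (lefts ys)" "0 \<notin> set (rights ys)"
    proof -
      have "Inl 0 \<notin> set xs" "Inr 0 \<notin> set xs" using in_xs[of 0] by simp_all
      then show "0 \<notin> set (lefts ys)" "0 \<notin> set (rights ys)"
        unfolding set_lefts set_rights using cases_xs by blast+
    qed
    have sum_A: "(\<Sum>p\<in>A. f (G ! p)) = f T + sum_list (map (\<lambda>p. f (G ! p)) (lefts ys))
        + sum_list (map (\<lambda>p. f (G ! p)) (lefts us))" for f :: "letter \<Rightarrow> int"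
    proof -
      have "(\<Sum>p\<in>A. f (G ! p)) = (\<Sum>p\<in>F. f (G ! p)) + (\<Sum>p\<in>set (lefts us). f (G ! p))"
        unfolding A_def
        by (rule sum.union_disjoint) (use lr(1) P(2) fin in \<open>auto\<close>)+
      then show ?thesis
        using zero(1) dist_ys(1) distinct_lefts[OF dist_us] unfolding F_def
        by (simp add: sum_set_distinct) (simp add: G_def)
    qed
    have sum_B: "(\<Sum>p\<in>B. f (H ! p)) = f S + sum_list (map (\<lambda>p. f (H ! p)) (rights ys))
        + sum_list (map (\<lambda>p. f (H ! p)) (rights us))" for f :: "letter \<Rightarrow> int"
    proof -
      have "(\<Sum>p\<in>B. f (H ! p)) = (\<Sum>p\<in>E. f (H ! p)) + (\<Sum>p\<in>set (rights us). f (H ! p))"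
        unfolding B_def
        by (rule sum.union_disjoint) (use lr(2) Q(2) fin in \<open>auto\<close>)+
      then show ?thesis
        using zero(2) dist_ys(2) distinct_rights[OF dist_us] unfolding E_def
        by (simp add: sum_set_distinct) (simp add: H_def)
    qed
    have x: "wx (nths G A) = wx (nths H B)" and y: "wy (nths G A) = wy (nths H B)"
      using sum_ys sum_us(1,2) unfolding wx_conv_sum_list wy_conv_sum_list
        sum_list_map_nths[OF AB(1)] sum_list_map_nths[OF AB(2)] sum_A[of lx] sum_B[of lx] sum_A[of ly] sum_B[of ly]
        fx_def fy_def sum_list_case_sum by simp_all
    \<comment> \<open>Since 0 is in \<open>A\<close> and \<open>B\<close>, the chosen subwords still
      begin with \<open>T\<close> and \<open>S\<close>.\<close>
    define g' where "g' = nths g {i. Suc i \<in> A}"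
    define h' where "h' = nths h {i. Suc i \<in> B}"
    have gh': "nths G A = T # g'" "nths H B = S # h'"
      unfolding G_def H_def g'_def h'_def nths_Cons A_def B_def F_def E_def by simp_all
    have "card A \<le> b + zero_sum_bound m 3" "card B \<le> b + zero_sum_bound m 3"
    proof -
      have "card A \<le> card F + card (set (lefts us))" "card B \<le> card E + card (set (rights us))"
        unfolding A_def B_def by (rule card_Un_le)+
      then show "card A \<le> b + zero_sum_bound m 3" "card B \<le> b + zero_sum_bound m 3"
        using card_FE len_us length_lefts[of us] length_rights[of us]
          card_length[of "lefts us"] card_length[of "rights us"] by linarith+
    qed
    then have "length g' \<le> word_bound K" "length h' \<le> word_bound K"
      using length_nths_le[OF AB(1)] length_nths_le[OF AB(2)] bound(1) unfolding gh' m_def by simp_all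
    moreover have "set g' \<subseteq> set g" "set h' \<subseteq> set h"
      unfolding g'_def h'_def by (rule set_nths_subset)+
    ultimately show ?thesis
      using x y z unfolding gh' by blast
  qed
qed

section \<open>Computable functions on coded types\<close>

lemma computes_Comp1:
  "computes g xs y \<Longrightarrow> computes f [y] z \<Longrightarrow> computes (Comp f [g]) xs z"
  by (rule computes.comp[where ys = "[y]"]) auto

lemma computes_Comp2:
  "computes g xs y \<Longrightarrow> computes h xs y' \<Longrightarrow> computes f [y, y'] z \<Longrightarrow>
    computes (Comp f [g, h]) xs z"
  by (rule computes.comp[where ys = "[y, y']"]) auto

lemma computes_Proj: "i < length xs \<Longrightarrow> y = xs ! i \<Longrightarrow> computes (Proj i) xs y"
  by (simp add: computes.proj)

lemma computes_Succ: "y = Suc x \<Longrightarrow> computes Succ [x] y"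
  by (simp add: computes.succ)

lemma computes_PrimRec:
  assumes "computes f xs (h 0)"
    and "\<And>k. k < n \<Longrightarrow> computes g (k # h k # xs) (h (Suc k))"
  shows "computes (PrimRec f g) (n # xs) (h n)"
  using assms(2) by (induction n) (auto intro: computes.intros assms(1))

section \<open>Arithmetic and Cantor pairing as recursive functions\<close>

definition Add_rec :: recf where "Add_rec = PrimRec (Proj 0) (Comp Succ [Proj 1])"

lemma computes_Add: "computes Add_rec [m, n] (m + n)"
  unfolding Add_rec_def
  by (rule computes_PrimRec[where h = "\<lambda>m. m + n"])
    (auto intro!: computes_Comp1 computes_Proj computes_Succ)

definition Pred_rec :: recf where "Pred_rec = PrimRec Zero (Proj 0)"

lemma computes_Pred: "computes Pred_rec [n] (n - 1)"
  unfolding Pred_rec_def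
  by (rule computes_PrimRec[where h = "\<lambda>n. n - 1"]) (auto intro!: computes.zero computes_Proj)

text \<open>The recursion variable comes first, so it is the first argument that is subtracted from
  the second.\<close>

definition Sub_rec :: recf where "Sub_rec = PrimRec (Proj 0) (Comp Pred_rec [Proj 1])"

lemma computes_Sub: "computes Sub_rec [n, m] (m - n)"
  unfolding Sub_rec_def
proof (rule computes_PrimRec[where h = "\<lambda>n. m - n"])
  fix k show "computes (Comp Pred_rec [Proj 1]) [k, m - k, m] (m - Suc k)"
    using computes_Pred[of "m - k"] by (auto intro!: computes_Comp1 computes_Proj)
qed (auto intro!: computes_Proj)

definition Mult_rec :: recf where "Mult_rec = PrimRec Zero (Comp Add_rec [Proj 1, Proj 2])"

lemma computes_Mult: "computes Mult_rec [m, n] (m * n)"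
  unfolding Mult_rec_def
proof (rule computes_PrimRec[where h = "\<lambda>m. m * n"])
  fix k show "computes (Comp Add_rec [Proj 1, Proj 2]) [k, k * n, n] (Suc k * n)"
    using computes_Add[of "k * n" n]
    by (auto intro!: computes_Comp2 computes_Proj simp: add.commute)
qed (auto intro!: computes.zero)

definition Triangle_rec :: recf where
  "Triangle_rec = PrimRec Zero (Comp Add_rec [Proj 1, Comp Succ [Proj 0]])"

lemma computes_Triangle: "computes Triangle_rec [n] (triangle n)"
  unfolding Triangle_rec_def
proof (rule computes_PrimRec[where h = triangle])
  fix k show "computes (Comp Add_rec [Proj 1, Comp Succ [Proj 0]]) [k, triangle k] (triangle (Suc k))"
    using computes_Add[of "triangle k" "Suc k"]
    by (auto intro!: computes_Comp2 computes_Comp1 computes_Proj computes_Succ)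
qed (auto intro!: computes.zero)

definition Pair_rec :: recf where
  "Pair_rec = Comp Add_rec [Comp Triangle_rec [Add_rec], Proj 0]"

lemma computes_Pair: "computes Pair_rec [m, n] (prod_encode (m, n))"
  unfolding Pair_rec_def prod_encode_def
  by (auto intro!: computes_Comp2 computes_Comp1 computes_Proj computes_Add computes_Triangle)

text \<open>\<open>prod_encode (m, n)\<close> is \<open>triangle (m + n) + m\<close>, so
  \<open>m + n\<close> is the least \<open>k\<close> for which the code lies below
  \<open>triangle (Suc k)\<close>. This is the only use of minimisation.\<close>

definition Diagonal_rec :: recf where
  "Diagonal_rec = Mu (Comp Sub_rec [Comp Triangle_rec [Comp Succ [Proj 0]], Comp Succ [Proj 1]])"

lemma triangle_mono: "m \<le> n \<Longrightarrow> triangle m \<le> triangle n"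
  by (induction n) (auto simp: le_Suc_eq)

lemma computes_Diagonal: "computes Diagonal_rec [prod_encode (m, n)] (m + n)"
proof -
  let ?z = "prod_encode (m, n)"
  have step: "computes (Comp Sub_rec [Comp Triangle_rec [Comp Succ [Proj 0]], Comp Succ [Proj 1]])
      [k, ?z] (Suc ?z - triangle (Suc k))" for k
    by (auto intro!: computes_Comp2 computes_Comp1 computes_Proj computes_Succ computes_Triangle
        computes_Sub simp del: triangle_Suc)
  show ?thesis
    unfolding Diagonal_rec_def
  proof (rule computes.mu)
    have "Suc ?z - triangle (Suc (m + n)) = 0" by (simp add: prod_encode_def)
    with step[of "m + n"]
    show "computes (Comp Sub_rec [Comp Triangle_rec [Comp Succ [Proj 0]], Comp Succ [Proj 1]])
      [m + n, ?z] 0" by simp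
  next
    fix i assume "i < m + n"
    then have "triangle (Suc i) \<le> ?z"
      using triangle_mono[of "Suc i" "m + n"] by (simp add: prod_encode_def)
    then have "Suc ?z - triangle (Suc i) = Suc (?z - triangle (Suc i))" by simp
    with step[of i]
    show "\<exists>y. computes (Comp Sub_rec [Comp Triangle_rec [Comp Succ [Proj 0]], Comp Succ [Proj 1]])
      [i, ?z] (Suc y)" by metis
  qed
qed

definition Fst_rec :: recf where
  "Fst_rec = Comp Sub_rec [Comp Triangle_rec [Diagonal_rec], Proj 0]"

lemma computes_Fst: "computes Fst_rec [prod_encode (m, n)] m"
proof -
  have "prod_encode (m, n) - triangle (m + n) = m" by (simp add: prod_encode_def)
  then show ?thesis
    unfolding Fst_rec_def
    using computes_Sub[of "triangle (m + n)" "prod_encode (m, n)"]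
    by (auto intro!: computes_Comp2 computes_Comp1 computes_Proj computes_Triangle computes_Diagonal)
qed

definition Snd_rec :: recf where
  "Snd_rec = Comp Sub_rec [Fst_rec, Diagonal_rec]"

lemma computes_Snd: "computes Snd_rec [prod_encode (m, n)] n"
  unfolding Snd_rec_def using computes_Sub[of m "m + n"]
  by (auto intro!: computes_Comp2 computes_Fst computes_Diagonal)

section \<open>Types with codes and the computable functions between them\<close>

class coded =
  fixes code :: "'a \<Rightarrow> nat"
  assumes code_inject: "code x = code y \<Longrightarrow> x = y"
begin

lemma code_eq_iff: "code x = code y \<longleftrightarrow> x = y"
  using code_inject by blast

end

instantiation nat :: coded
begin
definition code_nat :: "nat \<Rightarrow> nat" where [simp]: "code_nat n = n"
instance by standard simp
end

instantiation bool :: coded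
begin
definition code_bool :: "bool \<Rightarrow> nat" where "code_bool b = (if b then 1 else 0)"
instance by standard (simp add: code_bool_def split: if_splits)
end

instantiation int :: coded
begin
definition code_int :: "int \<Rightarrow> nat" where "code_int i = int_encode i"
instance by standard (simp add: code_int_def int_encode_eq)
end

instantiation prod :: (coded, coded) coded
begin
definition code_prod :: "'a \<times> 'b \<Rightarrow> nat" where
  "code_prod p = prod_encode (code (fst p), code (snd p))"
instance by standard (auto simp: code_prod_def code_eq_iff prod_eq_iff)
end

instantiation list :: (coded) coded
begin
definition code_list :: "'a list \<Rightarrow> nat" where
  "code_list xs = list_encode (map code xs)"
instance
  by standard (use code_inject in \<open>auto simp: code_list_def list_encode_eq inj_on_def dest!: map_injective\<close>)
end

lemma code_Pair: "code (x, y) = prod_encode (code x, code y)"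
  by (simp add: code_prod_def)

lemma code_Nil [simp]: "code [] = 0"
  by (simp add: code_list_def)

lemma code_Cons: "code (x # xs) = Suc (code (x, xs))"
  by (simp add: code_list_def code_prod_def)

text \<open>Unary functions suffice, since several arguments are packed into a tuple. Nothing is
  known about \<open>r\<close> on numbers that are not codes.\<close>

definition computable :: "('a::coded \<Rightarrow> 'b::coded) \<Rightarrow> bool" where
  "computable f \<longleftrightarrow> (\<exists>r. \<forall>x. computes r [code x] (code (f x)))"

named_theorems computable_intros

lemma computableI: "(\<And>x. computes r [code x] (code (f x))) \<Longrightarrow> computable f"
  unfolding computable_def by blast

lemma computable_id [computable_intros]: "computable (\<lambda>x. x)"
  by (rule computableI[of "Proj 0"]) (simp add: computes_Proj)

lemma computable_const [computable_intros]: "computable (\<lambda>x. c)"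
proof -
  have "\<exists>r. \<forall>xs. computes r xs n" for n
    by (induction n) (blast intro: computes.intros computes_Comp1)+
  then show ?thesis unfolding computable_def by blast
qed

lemma computable_cong_code:
  assumes "computable f" "\<And>x. code (f x) = code (g x)"
  shows "computable g"
  using assms unfolding computable_def by simp

lemma computable_comp1:
  assumes "computable F" "\<And>y. computes r [code y] (code (op y))"
  shows "computable (\<lambda>x. op (F x))"
proof -
  obtain rF where "\<And>x. computes rF [code x] (code (F x))"
    using assms(1) unfolding computable_def by blast
  then show ?thesis
    using assms(2) by (intro computableI[of "Comp r [rF]"] computes_Comp1)
qed

lemma computable_comp2:
  assumes "computable F" "computable G"
    and "\<And>y z. computes r [code y, code z] (code (op y z))"
  shows "computable (\<lambda>x. op (F x) (G x))"
proof -
  obtain rF where "\<And>x. computes rF [code x] (code (F x))"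
    using assms(1) unfolding computable_def by blast
  moreover obtain rG where "\<And>x. computes rG [code x] (code (G x))"
    using assms(2) unfolding computable_def by blast
  ultimately show ?thesis
    using assms(3) by (intro computableI[of "Comp r [rF, rG]"] computes_Comp2)
qed

lemma computable_compose:
  assumes "computable f" "computable F"
  shows "computable (\<lambda>x. f (F x))"
proof -
  obtain r where "\<And>x. computes r [code x] (code (f x))"
    using assms(1) unfolding computable_def by blast
  then show ?thesis by (rule computable_comp1[OF assms(2)])
qed

lemma computable_code [computable_intros]: "computable F \<Longrightarrow> computable (\<lambda>x. code (F x))"
  unfolding computable_def by simp

lemma computable_codeD: "computable (\<lambda>x. code (F x)) \<Longrightarrow> computable F"
  unfolding computable_def by simp

lemma computable_Suc [computable_intros]: "computable F \<Longrightarrow> computable (\<lambda>x. Suc (F x))"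
  by (erule computable_comp1[where r = Succ]) (simp add: computes_Succ)

lemma computable_add [computable_intros]:
  "computable F \<Longrightarrow> computable G \<Longrightarrow> computable (\<lambda>x. F x + (G x :: nat))"
  by (erule (1) computable_comp2[where r = Add_rec]) (simp add: computes_Add)

lemma computable_mult [computable_intros]:
  "computable F \<Longrightarrow> computable G \<Longrightarrow> computable (\<lambda>x. F x * (G x :: nat))"
  by (erule (1) computable_comp2[where r = Mult_rec]) (simp add: computes_Mult)

lemma computable_diff [computable_intros]:
  "computable F \<Longrightarrow> computable G \<Longrightarrow> computable (\<lambda>x. F x - (G x :: nat))"
  by (rule computable_comp2[where r = Sub_rec and op = "\<lambda>y z. z - y"]) (simp_all add: computes_Sub)

lemma computable_Pair [computable_intros]:
  "computable F \<Longrightarrow> computable G \<Longrightarrow> computable (\<lambda>x. (F x, G x))"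
  by (erule (1) computable_comp2[where r = Pair_rec]) (simp add: computes_Pair code_prod_def)

lemma computable_fst [computable_intros]: "computable F \<Longrightarrow> computable (\<lambda>x. fst (F x))"
  by (erule computable_comp1[where r = Fst_rec]) (simp add: computes_Fst code_prod_def)

lemma computable_snd [computable_intros]: "computable F \<Longrightarrow> computable (\<lambda>x. snd (F x))"
  by (erule computable_comp1[where r = Snd_rec]) (simp add: computes_Snd code_prod_def)

text \<open>The step receives the environment \<open>e\<close> besides counter and previous value,
  so bodies with free parameters are covered; its three arguments are packed into a tuple.\<close>

lemma computable_rec_nat [computable_intros]:
  assumes "computable N" "computable B"
    and "computable (\<lambda>p. S (fst p) (fst (snd p)) (snd (snd p)))"
  shows "computable (\<lambda>e. rec_nat (B e) (\<lambda>k r. S e k r) (N e))"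
proof -
  obtain rN where rN: "\<And>x. computes rN [code x] (N x)"
    using assms(1) unfolding computable_def code_nat_def by blast
  obtain rB where rB: "\<And>x. computes rB [code x] (code (B x))"
    using assms(2) unfolding computable_def by blast
  obtain rS where rS: "\<And>p. computes rS [code p] (code (S (fst p) (fst (snd p)) (snd (snd p))))"
    using assms(3) unfolding computable_def by blast
  let ?step = "Comp rS [Comp Pair_rec [Proj 2, Comp Pair_rec [Proj 0, Proj 1]]]"
  have "computes (PrimRec rB ?step) [n, code e] (code (rec_nat (B e) (\<lambda>k r. S e k r) n))" for n e
  proof (rule computes_PrimRec)
    fix k
    let ?r = "rec_nat (B e) (\<lambda>k r. S e k r) k"
    have "computes ?step [k, code ?r, code e] (code (S e k ?r))"
      using rS[of "(e, k, ?r)"]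
      by (intro computes_Comp1 computes_Comp2) (auto simp: code_prod_def intro!: computes_Proj computes_Pair)
    then show "computes ?step [k, code ?r, code e] (code (rec_nat (B e) (\<lambda>k r. S e k r) (Suc k)))"
      by simp
  qed (simp add: rB)
  then show ?thesis
    using rN by (intro computableI[of "Comp (PrimRec rB ?step) [rN, Proj 0]"] computes_Comp2)
      (auto intro: computes_Proj)
qed

lemma computable_if [computable_intros]:
  assumes "computable C" "computable F" "computable G"
  shows "computable (\<lambda>x. if C x then F x else G x)"
proof -
  \<comment> \<open>A truth value has code 0 or 1, so the recursion takes no step or exactly
    one.\<close>
  have "computable (\<lambda>x. rec_nat (G x) (\<lambda>_ _. F x) (code (C x)))"
    by (intro computable_intros assms computable_compose[OF assms(2)])
  then show ?thesis
    by (rule computable_cong_code) (simp add: code_bool_def)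
qed

lemma computable_le [computable_intros]:
  assumes "computable F" "computable G"
  shows "computable (\<lambda>x. F x \<le> (G x :: nat))"
  by (rule computable_codeD, rule computable_cong_code[of "\<lambda>x. 1 - (F x - G x)"],
      intro computable_intros assms) (simp add: code_bool_def)

lemma computable_conj [computable_intros]:
  assumes "computable F" "computable G"
  shows "computable (\<lambda>x. F x \<and> G x)"
  by (rule computable_cong_code[of "\<lambda>x. if F x then G x else False"], intro computable_intros assms) simp

lemma computable_disj [computable_intros]:
  assumes "computable F" "computable G"
  shows "computable (\<lambda>x. F x \<or> G x)"
  by (rule computable_cong_code[of "\<lambda>x. if F x then True else G x"], intro computable_intros assms) simp

lemma computable_not [computable_intros]:
  assumes "computable F"
  shows "computable (\<lambda>x. \<not> F x)"
  by (rule computable_cong_code[of "\<lambda>x. if F x then False else True"], intro computable_intros assms) simp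

lemma computable_eq [computable_intros]:
  assumes "computable F" "computable G"
  shows "computable (\<lambda>x. F x = G x)"
  by (rule computable_cong_code[of "\<lambda>x. code (F x) \<le> code (G x) \<and> code (G x) \<le> code (F x)"],
      intro computable_intros assms) (simp add: eq_iff[symmetric] code_eq_iff)

lemma computable_power [computable_intros]:
  assumes "computable F" "computable G"
  shows "computable (\<lambda>x. F x ^ G x :: nat)"
proof (rule computable_cong_code)
  show "computable (\<lambda>x. rec_nat 1 (\<lambda>_ r. F x * r) (G x))"
    by (intro computable_intros assms computable_compose[OF assms(1)])
  have "rec_nat 1 (\<lambda>_ r. m * r) n = m ^ n" for m n :: nat
    by (induction n) simp_all
  then show "code (rec_nat 1 (\<lambda>_ r. F x * r) (G x)) = code (F x ^ G x)" for x
    by simp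
qed

lemma computable_fact [computable_intros]:
  assumes "computable F"
  shows "computable (\<lambda>x. fact (F x) :: nat)"
proof (rule computable_cong_code)
  show "computable (\<lambda>x. rec_nat 1 (\<lambda>k r. Suc k * r) (F x))"
    by (intro computable_intros assms)
  have "rec_nat 1 (\<lambda>k r. Suc k * r) n = (fact n :: nat)" for n
    by (induction n) simp_all
  then show "code (rec_nat 1 (\<lambda>k r. Suc k * r) (F x)) = code (fact (F x) :: nat)" for x
    by simp
qed

text \<open>Quotient and parity are carried together, since the parity decides when the quotient
  grows.\<close>

lemma half_parity_rec:
  "rec_nat (0, True) (\<lambda>_ r. (if snd r then fst r else Suc (fst r), \<not> snd r)) n = (n div 2, even n)"
  by (induction n) auto

lemma computable_half_even:
  assumes "computable F"
  shows "computable (\<lambda>x. (F x div 2, even (F x :: nat)))"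
  unfolding half_parity_rec[symmetric] by (intro computable_intros assms)

lemma computable_half: "computable F \<Longrightarrow> computable (\<lambda>x. F x div (2::nat))"
  using computable_fst[OF computable_half_even] by simp

lemma computable_even: "computable F \<Longrightarrow> computable (\<lambda>x. even (F x :: nat))"
  using computable_snd[OF computable_half_even] by simp

section \<open>Integer arithmetic through codes\<close>

lemma code_int_eq: "code i = (if 0 \<le> i then 2 * nat i else 2 * nat (- i) - 1)"
  by (auto simp: code_int_def int_encode_def sum_encode_def nat_diff_distrib)

lemma computable_nat [computable_intros]:
  assumes "computable F"
  shows "computable (\<lambda>x. nat (F x))"
proof (rule computable_cong_code)
  show "computable (\<lambda>x. if even (code (F x)) then code (F x) div 2 else 0)"
    by (intro computable_intros computable_half computable_even assms)
qed (auto simp: code_int_eq)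

lemma computable_nat_uminus:
  assumes "computable F"
  shows "computable (\<lambda>x. nat (- F x))"
proof (rule computable_cong_code)
  show "computable (\<lambda>x. if even (code (F x)) then 0 else Suc (code (F x) div 2))"
    by (intro computable_intros computable_half computable_even assms)
qed (auto simp: code_int_eq)

text \<open>Sums and products of integers are computed on positive and negative parts; this puts the
  result together again.\<close>

lemma computable_int_diff:
  assumes "computable F" "computable G"
  shows "computable (\<lambda>x. int (F x) - int (G x))"
proof (rule computable_codeD, rule computable_cong_code)
  show "computable (\<lambda>x. if G x \<le> F x then 2 * (F x - G x) else 2 * (G x - F x) - 1)"
    by (intro computable_intros assms)
qed (auto simp: code_int_eq nat_diff_distrib)

lemma computable_int_add [computable_intros]:
  assumes "computable F" "computable G"
  shows "computable (\<lambda>x. F x + (G x :: int))"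
proof -
  have "computable (\<lambda>x. int (nat (F x) + nat (G x)) - int (nat (- F x) + nat (- G x)))"
    by (intro computable_int_diff computable_intros computable_nat_uminus assms)
  then show ?thesis by (rule computable_cong_code) (auto intro!: arg_cong[where f = code])
qed

lemma computable_int_mult [computable_intros]:
  assumes "computable F" "computable G"
  shows "computable (\<lambda>x. F x * (G x :: int))"
proof -
  have "computable (\<lambda>x. int (nat (F x) * nat (G x) + nat (- F x) * nat (- G x))
      - int (nat (- F x) * nat (G x) + nat (F x) * nat (- G x)))"
    by (intro computable_int_diff computable_intros computable_nat_uminus assms)
  moreover have "int (nat i * nat j + nat (- i) * nat (- j)) - int (nat (- i) * nat j + nat i * nat (- j))
      = i * j" for i j
    by (cases "i \<ge> 0"; cases "j \<ge> 0") auto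
  ultimately show ?thesis by simp
qed

lemma computable_int [computable_intros]:
  "computable F \<Longrightarrow> computable (\<lambda>x. int (F x))"
  using computable_int_diff[OF _ computable_const[of 0]] by simp

section \<open>Lists\<close>

lemma computable_Cons [computable_intros]:
  assumes "computable F" "computable G"
  shows "computable (\<lambda>x. F x # G x)"
  by (rule computable_codeD, unfold code_Cons) (intro computable_intros assms)

text \<open>The code of a nonempty list is the successor of the code of head and tail. A primitive
  recursion of length 0 or 1 makes the case distinction, so that \<open>rC\<close> is never run on
  the empty list, where the predecessor need not be the code of a pair.\<close>

lemma computable_case_list [computable_intros]:
  assumes "computable L" "computable N"
    and "computable (\<lambda>p. C (fst p) (fst (snd p)) (snd (snd p)))"
  shows "computable (\<lambda>e. case L e of [] \<Rightarrow> N e | x # xs \<Rightarrow> C e x xs)"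
proof -
  have "computable (\<lambda>e. code (L e) - 1)" "computable (\<lambda>e. 1 - (1 - code (L e)))"
    by (intro computable_intros assms)+
  then obtain rL rT where rL: "\<And>e. computes rL [code e] (code (L e) - 1)"
    and rT: "\<And>e. computes rT [code e] (1 - (1 - code (L e)))"
    unfolding computable_def code_nat_def by blast
  obtain rN where rN: "\<And>x. computes rN [code x] (code (N x))"
    using assms(2) unfolding computable_def by blast
  obtain rC where rC: "\<And>p. computes rC [code p] (code (C (fst p) (fst (snd p)) (snd (snd p))))"
    using assms(3) unfolding computable_def by blast
  let ?step = "Comp rC [Comp Pair_rec [Proj 2, Comp rL [Proj 2]]]"
  show ?thesis
  proof (rule computableI[of "Comp (PrimRec rN ?step) [rT, Proj 0]"])
    fix e
    show "computes (Comp (PrimRec rN ?step) [rT, Proj 0]) [code e]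
        (code (case L e of [] \<Rightarrow> N e | x # xs \<Rightarrow> C e x xs))"
    proof (cases "L e")
      case Nil
      then show ?thesis
        using rT[of e] rN[of e] by (auto intro!: computes_Comp2 computes_Proj computes.prim_0)
    next
      case (Cons x xs)
      have "computes rL [code e] (code (x, xs))"
        using rL[of e] Cons by (simp add: code_Cons)
      then have "computes ?step [0, code (N e), code e] (code (C e x xs))"
        using rC[of "(e, x, xs)"]
        by (intro computes_Comp1 computes_Comp2) (auto simp: code_prod_def intro!: computes_Proj computes_Pair)
      moreover have "computes rT [code e] (Suc 0)"
        using rT[of e] Cons by (simp add: code_Cons)
      ultimately show ?thesis
        using rN[of e] Cons by (auto intro!: computes_Comp2 computes_Proj computes.prim_Suc computes.prim_0)
    qed
  qed
qed

lemma length_le_code: "length xs \<le> code xs"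
  by (induction xs) (auto simp: code_Cons code_prod_def intro: le_trans[OF _ le_prod_encode_2])

text \<open>The state is the unread list with the accumulator, and the step idles once the list is
  empty. Any upper bound of the length will do, in particular the code of the list.\<close>

lemma fold_eq_rec_nat:
  "length xs \<le> n \<Longrightarrow> fold f xs a =
    snd (rec_nat (xs, a) (\<lambda>_ p. case fst p of [] \<Rightarrow> p | x # ys \<Rightarrow> (ys, f x (snd p))) n)"
proof (induction n arbitrary: xs a)
  case (Suc n)
  let ?s = "\<lambda>p. case fst p of [] \<Rightarrow> p | x # ys \<Rightarrow> (ys, f x (snd p))"
  \<comment> \<open>The step ignores the counter, so its outermost application can be moved to the
    start, where \<open>fold\<close> reads its first element.\<close>
  have *: "rec_nat p (\<lambda>_. ?s) (Suc n) = rec_nat (?s p) (\<lambda>_. ?s) n" for p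
    by (induction n) auto
  show ?case
    using Suc.prems Suc.IH[of "tl xs"] Suc.IH[of "[]"] by (cases xs) (simp_all only: *, auto)
qed auto

lemma computable_fold [computable_intros]:
  assumes "computable L" "computable A"
    and S: "computable (\<lambda>p. S (fst p) (fst (snd p)) (snd (snd p)))"
  shows "computable (\<lambda>e. fold (\<lambda>x a. S e x a) (L e) (A e))"
proof -
  have [computable_intros]: "computable F \<Longrightarrow> computable G \<Longrightarrow> computable H \<Longrightarrow> computable (\<lambda>x. S (F x) (G x) (H x))"
    for F :: "'x::coded \<Rightarrow> _" and G H
    using computable_compose[OF S, of "\<lambda>x. (F x, G x, H x)"] by (simp add: computable_intros)
  show ?thesis
    unfolding fold_eq_rec_nat[OF length_le_code]
    by (intro computable_intros assms(1,2))
qed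

lemma computable_rev [computable_intros]:
  assumes "computable L" shows "computable (\<lambda>e. rev (L e))"
  unfolding rev_conv_fold by (intro computable_intros assms)

lemma computable_append [computable_intros]:
  assumes "computable L" "computable M"
  shows "computable (\<lambda>e. L e @ M e)"
proof -
  have "L e @ M e = fold (\<lambda>x xs. x # xs) (rev (L e)) (M e)" for e
    by (simp add: fold_Cons_rev)
  then show ?thesis by (simp only:) (intro computable_intros assms)
qed

lemma computable_concat [computable_intros]:
  assumes "computable L" shows "computable (\<lambda>e. concat (L e))"
proof -
  have "concat xs = fold (\<lambda>x a. x @ a) (rev xs) []" for xs :: "'b list list"
    by (simp add: foldr_conv_fold[symmetric] concat_conv_foldr)
  then show ?thesis by (simp only:) (intro computable_intros assms)
qed

lemma computable_map [computable_intros]: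
  assumes "computable L" and S: "computable (\<lambda>p. S (fst p) (snd p))"
  shows "computable (\<lambda>e. map (\<lambda>x. S e x) (L e))"
proof -
  have "fold (\<lambda>x a. S e x # a) xs ys = rev (map (S e) xs) @ ys" for e xs ys
    by (induction xs arbitrary: ys) auto
  then have *: "map (S e) xs = rev (fold (\<lambda>x a. S e x # a) xs [])" for e xs
    by simp
  show ?thesis
    unfolding *
    by (intro computable_intros assms computable_compose[OF S, of "\<lambda>p. (fst p, fst (snd p))", simplified])
qed

lemma computable_list_ex [computable_intros]:
  assumes "computable L" and S: "computable (\<lambda>p. S (fst p) (snd p))"
  shows "computable (\<lambda>e. list_ex (\<lambda>x. S e x) (L e))"
proof -
  have "fold (\<lambda>x a. S e x \<or> a) xs b = (list_ex (S e) xs \<or> b)" for e xs b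
    by (induction xs arbitrary: b) auto
  then have *: "list_ex (S e) xs = fold (\<lambda>x a. S e x \<or> a) xs False" for e xs
    by simp
  show ?thesis
    unfolding *
    by (intro computable_intros assms computable_compose[OF S, of "\<lambda>p. (fst p, fst (snd p))", simplified])
qed

section \<open>Deciding the orbit intersection problem\<close>

subsection \<open>Computability of the length bound\<close>

lemma zero_sum_bound_rec:
  "zero_sum_bound m k = rec_nat 1 (\<lambda>_ b. b * (2 * (m * b) + 1)) k"
  by (induction k) simp_all

lemma computable_zero_sum_bound [computable_intros]:
  assumes "computable F" "computable G"
  shows "computable (\<lambda>x. zero_sum_bound (F x) (G x))"
  unfolding zero_sum_bound_rec
  by (intro computable_intros assms(2) computable_compose[OF assms(1)])

lemma computable_wz_bound [computable_intros]:
  "computable F \<Longrightarrow> computable G \<Longrightarrow> computable (\<lambda>x. wz_bound (F x) (G x))"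
  unfolding wz_bound_def by (intro computable_intros)

lemma computable_congruent_bound [computable_intros]:
  "computable F \<Longrightarrow> computable (\<lambda>x. congruent_bound (F x))"
  unfolding congruent_bound_def by (intro computable_intros)

lemma computable_noncommuting_bound [computable_intros]:
  "computable F \<Longrightarrow> computable G \<Longrightarrow> computable (\<lambda>x. noncommuting_bound (F x) (G x))"
  unfolding noncommuting_bound_def deviation_bound_def by (intro computable_intros)

lemma computable_word_bound [computable_intros]:
  "computable F \<Longrightarrow> computable (\<lambda>x. word_bound (F x))"
  unfolding word_bound_def Let_def by (intro computable_intros)

text \<open>If all codes are at most \<open>n\<close>, so are all denominators, and
  \<open>q = fact n\<close> is a common multiple of them. The summands bound \<open>q * a\<close>
  and \<open>q * b\<close>, then \<open>2 * q * (q * c)\<close>, then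
  \<open>(q * a) * (q * b)\<close>.\<close>

definition entry_bound :: "nat \<Rightarrow> nat" where
  "entry_bound n = fact n * n + 2 * fact n * (fact n * n) + (fact n * n) * (fact n * n)"

text \<open>The argument of \<open>word_bound\<close> bounds a product of two letters, because the
  base letter will be the base point times the first matrix of the word.\<close>

definition search_bound :: "nat \<Rightarrow> nat" where
  "search_bound n = word_bound (2 * entry_bound n + 2 * entry_bound n * entry_bound n)"

lemma computable_search_bound [computable_intros]:
  "computable F \<Longrightarrow> computable (\<lambda>x. search_bound (F x))"
  unfolding search_bound_def entry_bound_def by (intro computable_intros)

subsection \<open>The search\<close>

text \<open>Fractions are not reduced, so that no division is needed.\<close>

type_synonym fraction = "int \<times> nat"
type_synonym triple = "fraction \<times> fraction \<times> fraction"

definition frac_add :: "fraction \<Rightarrow> fraction \<Rightarrow> fraction" where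
  "frac_add p q = (fst p * int (snd q) + fst q * int (snd p), snd p * snd q)"

definition frac_mult :: "fraction \<Rightarrow> fraction \<Rightarrow> fraction" where
  "frac_mult p q = (fst p * fst q, snd p * snd q)"

definition frac_eq :: "fraction \<Rightarrow> fraction \<Rightarrow> bool" where
  "frac_eq p q \<longleftrightarrow> fst p * int (snd q) = fst q * int (snd p)"

definition triple_mult :: "triple \<Rightarrow> triple \<Rightarrow> triple" where
  "triple_mult x y = (frac_add (fst x) (fst y), frac_add (fst (snd x)) (fst (snd y)),
     frac_add (frac_add (snd (snd x)) (snd (snd y))) (frac_mult (fst x) (fst (snd y))))"

definition triple_eq :: "triple \<Rightarrow> triple \<Rightarrow> bool" where
  "triple_eq x y \<longleftrightarrow> frac_eq (fst x) (fst y) \<and> frac_eq (fst (snd x)) (fst (snd y)) \<and>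
     frac_eq (snd (snd x)) (snd (snd y))"

text \<open>Words of length 1 to \<open>n + 1\<close> are applied to \<open>x\<close>; starting with
  one factor excludes the empty word.\<close>

definition orbit :: "nat \<Rightarrow> triple \<Rightarrow> triple list \<Rightarrow> triple list" where
  "orbit n x ys = rec_nat (map (\<lambda>y. triple_mult x y) ys)
     (\<lambda>_ us. us @ concat (map (\<lambda>u. map (\<lambda>y. triple_mult u y) ys) us)) n"

definition orbits_disjoint :: "triple \<times> triple \<times> triple list \<times> triple list \<Rightarrow> bool" where
  "orbits_disjoint I \<longleftrightarrow>
     \<not> list_ex (\<lambda>u. list_ex (\<lambda>v. triple_eq u v)
          (orbit (search_bound (code I)) (fst (snd I)) (snd (snd (snd I)))))
        (orbit (search_bound (code I)) (fst I) (fst (snd (snd I))))"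

lemma computable_orbits_disjoint: "computable orbits_disjoint"
proof -
  have "computable (\<lambda>I. orbits_disjoint I)"
    unfolding orbits_disjoint_def orbit_def triple_eq_def triple_mult_def frac_add_def frac_mult_def frac_eq_def
    by (intro computable_intros)
  then show ?thesis .
qed

subsection \<open>Correctness of the search\<close>

definition frac_val :: "fraction \<Rightarrow> rat" where
  "frac_val p = of_int (fst p) / of_nat (snd p)"

definition triple_val :: "triple \<Rightarrow> rat^3^3" where
  "triple_val x = heis (frac_val (fst x)) (frac_val (fst (snd x))) (frac_val (snd (snd x)))"

definition proper :: "triple \<Rightarrow> bool" where
  "proper x \<longleftrightarrow> snd (fst x) > 0 \<and> snd (fst (snd x)) > 0 \<and> snd (snd (snd x)) > 0"

lemma frac_val_add: "snd p > 0 \<Longrightarrow> snd q > 0 \<Longrightarrow> frac_val (frac_add p q) = frac_val p + frac_val q"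
  by (simp add: frac_val_def frac_add_def field_simps)

lemma frac_val_mult: "frac_val (frac_mult p q) = frac_val p * frac_val q"
  by (simp add: frac_val_def frac_mult_def)

lemma snd_frac_pos:
  "snd p > 0 \<Longrightarrow> snd q > 0 \<Longrightarrow> snd (frac_add p q) > 0"
  "snd p > 0 \<Longrightarrow> snd q > 0 \<Longrightarrow> snd (frac_mult p q) > 0"
  by (simp_all add: frac_add_def frac_mult_def)

lemma frac_eq_iff:
  assumes "snd p > 0" "snd q > 0"
  shows "frac_eq p q \<longleftrightarrow> frac_val p = frac_val q"
proof -
  have "frac_val p = frac_val q \<longleftrightarrow>
      (of_int (fst p * int (snd q)) :: rat) = of_int (fst q * int (snd p))"
    using assms by (simp add: frac_val_def field_simps)
  then show ?thesis unfolding frac_eq_def of_int_eq_iff by simp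
qed

lemma heis_eq_iff: "heis a b c = heis a' b' c' \<longleftrightarrow> a = a' \<and> b = b' \<and> c = c'"
  by (metis heis_nth(2,3,6))

lemma triple_val_mult:
  "proper x \<Longrightarrow> proper y \<Longrightarrow> triple_val (triple_mult x y) = triple_val x ** triple_val y"
  unfolding proper_def triple_val_def triple_mult_def heis_mult fst_conv snd_conv
  by (simp add: frac_val_add frac_val_mult snd_frac_pos)

lemma proper_mult: "proper x \<Longrightarrow> proper y \<Longrightarrow> proper (triple_mult x y)"
  by (simp add: proper_def triple_mult_def snd_frac_pos)

lemma triple_eq_iff: "proper x \<Longrightarrow> proper y \<Longrightarrow> triple_eq x y \<longleftrightarrow> triple_val x = triple_val y"
  by (simp add: triple_eq_def triple_val_def heis_eq_iff frac_eq_iff proper_def)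

text \<open>\<open>orbit\<close> extends words at their end, whereas \<open>foldr\<close> unfolds at
  the front; this lemma splits off the last factor.\<close>

lemma foldr_matrix_mult: "foldr (**) Ms M = foldr (**) Ms (mat 1) ** M" for M :: "rat^3^3"
  by (induction Ms) (simp_all add: matrix_mul_assoc)

lemma set_orbit:
  "set (orbit 0 x ys) = triple_mult x ` set ys"
  "set (orbit (Suc n) x ys) =
     set (orbit n x ys) \<union> (\<Union>u\<in>set (orbit n x ys). triple_mult u ` set ys)"
  by (simp_all add: orbit_def)

lemma orbit_proper:
  assumes "proper x" "\<forall>y\<in>set ys. proper y"
  shows "\<forall>u\<in>set (orbit n x ys). proper u"
proof (induction n)
  case 0
  then show ?case unfolding set_orbit using assms by (simp add: proper_mult del: split_paired_All)
next
  case (Suc n)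
  then show ?case unfolding set_orbit using assms(2) by (simp add: ball_Un proper_mult)
qed

lemma orbit_val:
  assumes "proper x" "\<forall>y\<in>set ys. proper y"
  shows "triple_val ` set (orbit n x ys) = {triple_val x ** foldr (**) Ms (mat 1) | Ms.
    Ms \<noteq> [] \<and> set Ms \<subseteq> triple_val ` set ys \<and> length Ms \<le> Suc n}"
proof (induction n)
  case 0
  have "triple_val ` set (orbit 0 x ys) = (\<lambda>M. triple_val x ** M) ` triple_val ` set ys"
    unfolding set_orbit image_image using assms by (intro image_cong) (simp_all add: triple_val_mult)
  also have "\<dots> = {triple_val x ** foldr (**) Ms (mat 1) | Ms.
      Ms \<noteq> [] \<and> set Ms \<subseteq> triple_val ` set ys \<and> length Ms \<le> Suc 0}"
    (is "?L = ?R")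
  proof (intro set_eqI iffI)
    fix M assume "M \<in> ?L"
    then obtain y where "y \<in> triple_val ` set ys" "M = triple_val x ** y" by blast
    then show "M \<in> ?R" by (intro CollectI exI[of _ "[y]"]) simp
  next
    fix M assume "M \<in> ?R"
    then obtain Ms where Ms: "Ms \<noteq> []" "set Ms \<subseteq> triple_val ` set ys" "length Ms \<le> Suc 0"
      "M = triple_val x ** foldr (**) Ms (mat 1)" by blast
    then obtain y where "Ms = [y]" by (cases Ms) auto
    with Ms show "M \<in> ?L" by auto
  qed
  finally show ?case .
next
  case (Suc n)
  let ?Y = "triple_val ` set ys"
  let ?R = "\<lambda>n. {triple_val x ** foldr (**) Ms (mat 1) | Ms. Ms \<noteq> [] \<and> set Ms \<subseteq> ?Y \<and> length Ms \<le> Suc n}"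
  have "triple_val ` set (orbit (Suc n) x ys) = triple_val ` set (orbit n x ys) \<union>
      (\<Union>u\<in>set (orbit n x ys). (\<lambda>y. triple_val (triple_mult u y)) ` set ys)"
    unfolding set_orbit image_Un image_UN image_image ..
  also have "(\<Union>u\<in>set (orbit n x ys). (\<lambda>y. triple_val (triple_mult u y)) ` set ys) =
      (\<Union>u\<in>set (orbit n x ys). (\<lambda>y. triple_val u ** triple_val y) ` set ys)"
    using orbit_proper[OF assms, of n] assms(2)
    by (intro SUP_cong image_cong) (simp_all add: triple_val_mult)
  also have "\<dots> = (\<Union>M\<in>triple_val ` set (orbit n x ys). (\<lambda>N. M ** N) ` ?Y)"
    unfolding image_image ..
  also have "triple_val ` set (orbit n x ys) \<union> \<dots> = ?R n \<union> (\<Union>M\<in>?R n. (\<lambda>N. M ** N) ` ?Y)"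
    unfolding Suc.IH ..
  also have "\<dots> = ?R (Suc n)"
  proof (intro set_eqI iffI)
    fix M assume "M \<in> ?R n \<union> (\<Union>M\<in>?R n. (\<lambda>N. M ** N) ` ?Y)"
    then consider "M \<in> ?R n" | M' N where "M' \<in> ?R n" "N \<in> ?Y" "M = M' ** N" by blast
    then show "M \<in> ?R (Suc n)"
    proof cases
      case 1
      then show ?thesis by (auto intro: le_SucI)
    next
      case 2
      then obtain Ms where "Ms \<noteq> []" "set Ms \<subseteq> ?Y" "length Ms \<le> Suc n"
        "M' = triple_val x ** foldr (**) Ms (mat 1)" by blast
      with 2(2,3) show ?thesis
        by (intro CollectI exI[of _ "Ms @ [N]"])
          (simp add: foldr_matrix_mult[of Ms N] matrix_mul_assoc)
    qed
  next
    fix M assume "M \<in> ?R (Suc n)"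
    then obtain Ms where Ms: "Ms \<noteq> []" "set Ms \<subseteq> ?Y" "length Ms \<le> Suc (Suc n)"
      "M = triple_val x ** foldr (**) Ms (mat 1)" by blast
    show "M \<in> ?R n \<union> (\<Union>M\<in>?R n. (\<lambda>N. M ** N) ` ?Y)"
    proof (cases "length Ms \<le> Suc n")
      case True
      with Ms show ?thesis by blast
    next
      case False
      then obtain Ms' N where Ms': "Ms = Ms' @ [N]" using Ms(1) by (metis rev_exhaust)
      with False have "Ms' \<noteq> []" by auto
      then have "triple_val x ** foldr (**) Ms' (mat 1) \<in> ?R n" using Ms(2,3) Ms' by auto
      moreover have "M = (triple_val x ** foldr (**) Ms' (mat 1)) ** N"
        unfolding Ms(4) Ms' by (simp add: foldr_matrix_mult[of Ms' N] matrix_mul_assoc)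
      moreover have "N \<in> ?Y" using Ms(2) Ms' by simp
      ultimately show ?thesis by blast
    qed
  qed
  finally show ?case .
qed

subsection \<open>Reduction to integer letters\<close>

text \<open>The third coordinate has degree two under the dilations of the group, so the factor
  \<open>q ^ 2\<close> preserves the group law. A relation is used because a letter exists only if
  \<open>q\<close> clears the denominators.\<close>

definition scaled :: "nat \<Rightarrow> rat^3^3 \<Rightarrow> letter \<Rightarrow> bool" where
  "scaled q M l \<longleftrightarrow> of_int (lx l) = of_nat q * M $ 1 $ 2 \<and> of_int (ly l) = of_nat q * M $ 2 $ 3 \<and>
     of_int (lz l) = of_nat q ^ 2 * (2 * M $ 1 $ 3 - M $ 1 $ 2 * M $ 2 $ 3)"

definition letter_mult :: "letter \<Rightarrow> letter \<Rightarrow> letter" where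
  "letter_mult l m = (lx l + lx m, ly l + ly m, lz l + lz m + cross l m)"

definition word_value :: "letter list \<Rightarrow> letter" where
  "word_value w = (wx w, wy w, wz w)"

lemma word_value_Cons: "word_value (l # w) = letter_mult l (word_value w)"
  by (simp add: word_value_def letter_mult_def cross_def)

lemma H3E:
  assumes "M \<in> H3"
  obtains a b c where "M = heis a b c"
  using assms unfolding H3_def by blast

lemma scaled_mult:
  assumes "M \<in> H3" "N \<in> H3" "scaled q M l" "scaled q N m"
  shows "scaled q (M ** N) (letter_mult l m)"
proof -
  obtain a b c where M: "M = heis a b c" using assms(1) by (rule H3E)
  obtain a' b' c' where N: "N = heis a' b' c'" using assms(2) by (rule H3E)
  show ?thesis
    using assms(3,4) unfolding M N scaled_def letter_mult_def cross_def heis_mult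
    by (simp add: algebra_simps power2_eq_square)
qed

lemma H3_mult: "M \<in> H3 \<Longrightarrow> N \<in> H3 \<Longrightarrow> M ** N \<in> H3"
  by (elim H3E) (simp only: heis_mult, auto simp: H3_def)

lemma mat_1_eq_heis: "(mat 1 :: rat^3^3) = heis 0 0 0"
  by (simp add: vec_eq_iff forall_3 mat_def)

lemma scaled_foldr:
  assumes "\<forall>M\<in>set Ms. M \<in> H3 \<and> scaled q M (f M)"
  shows "foldr (**) Ms (mat 1) \<in> H3 \<and> scaled q (foldr (**) Ms (mat 1)) (word_value (map f Ms))"
  using assms
proof (induction Ms)
  case Nil
  have "mat 1 \<in> H3" unfolding mat_1_eq_heis H3_def by blast
  moreover have "scaled q (mat 1) (word_value [])"
    unfolding mat_1_eq_heis by (simp add: scaled_def word_value_def)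
  ultimately show ?case by simp
next
  case (Cons M Ms)
  then show ?case
    unfolding list.map word_value_Cons foldr_Cons o_apply by (auto intro: scaled_mult H3_mult)
qed

lemma scaled_eq_iff:
  assumes "M \<in> H3" "N \<in> H3" "scaled q M l" "scaled q N m" "q > 0"
  shows "M = N \<longleftrightarrow> l = m"
proof -
  obtain a b c where M: "M = heis a b c" using assms(1) by (rule H3E)
  obtain a' b' c' where N: "N = heis a' b' c'" using assms(2) by (rule H3E)
  have q: "(of_nat q :: rat) \<noteq> 0" using assms(5) by simp
  have M': "of_int (lx l) = of_nat q * a" "of_int (ly l) = of_nat q * b"
    "of_int (lz l) = of_nat q ^ 2 * (2 * c - a * b)"
    using assms(3) unfolding M scaled_def by simp_all
  have N': "of_int (lx m) = of_nat q * a'" "of_int (ly m) = of_nat q * b'"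
    "of_int (lz m) = of_nat q ^ 2 * (2 * c' - a' * b')"
    using assms(4) unfolding N scaled_def by simp_all
  have "lx l = lx m \<longleftrightarrow> a = a'"
    using q M'(1) N'(1) by (metis mult_left_cancel of_int_eq_iff)
  moreover have "ly l = ly m \<longleftrightarrow> b = b'"
    using q M'(2) N'(2) by (metis mult_left_cancel of_int_eq_iff)
  moreover have "lz l = lz m \<longleftrightarrow> 2 * c - a * b = 2 * c' - a' * b'"
    using q M'(3) N'(3) by (metis mult_left_cancel of_int_eq_iff power_not_zero)
  ultimately show ?thesis
    unfolding M N heis_eq_iff prod_eq_iff by auto
qed

lemma abs_le_int_encode: "\<bar>i\<bar> \<le> int (int_encode i)"
  by (auto simp: int_encode_def sum_encode_def)

lemma scaled_entry:
  assumes "rat_code r \<le> n"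
  obtains i where "of_int i = of_nat (fact n) * r" "\<bar>i\<bar> \<le> int (fact n * n)"
proof -
  obtain k d where kd: "quotient_of r = (k, d)" by fastforce
  have d: "d > 0" using quotient_of_denom_pos[OF kd] .
  have r: "r = of_int k / of_int d" using quotient_of_div[OF kd] .
  have "int_encode k \<le> rat_code r" "nat d \<le> rat_code r"
    unfolding rat_code_def kd by (simp_all add: le_prod_encode_1 le_prod_encode_2)
  then have k: "\<bar>k\<bar> \<le> int n" and dn: "nat d \<le> n"
    using assms abs_le_int_encode[of k] by linarith+
  have "nat d dvd fact n" using d dn by (intro dvd_fact) auto
  then obtain e where e: "fact n = nat d * e" by blast
  show ?thesis
  proof
    have "(of_nat (fact n) :: rat) = of_int d * of_nat e"
      unfolding e using d by simp
    then show "of_int (k * int e) = of_nat (fact n) * r"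
      unfolding r using d by simp
    have "1 \<le> nat d" using d by simp
    then have "e \<le> fact n" unfolding e by simp
    then have "int e \<le> int (fact n)" by (simp only: of_nat_le_iff)
    then have "\<bar>k\<bar> * int e \<le> int n * int (fact n)" using k by (intro mult_mono) simp_all
    then show "\<bar>k * int e\<bar> \<le> int (fact n * n)" by (simp add: abs_mult mult.commute)
  qed
qed

lemma scaled_letter:
  assumes "M \<in> H3" "heis_code M \<le> n"
  shows "\<exists>l. scaled (fact n) M l \<and> letter_le (entry_bound n) l"
proof -
  obtain a b c where M: "M = heis a b c" using assms(1) by (rule H3E)
  have le: "rat_code a \<le> n" "rat_code b \<le> n" "rat_code c \<le> n"
    using assms(2) unfolding M heis_code_def heis_nth
    by (meson le_prod_encode_1 le_prod_encode_2 order_trans)+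
  obtain i where i: "of_int i = of_nat (fact n) * a" "\<bar>i\<bar> \<le> int (fact n * n)"
    using scaled_entry[OF le(1)] by blast
  obtain j where j: "of_int j = of_nat (fact n) * b" "\<bar>j\<bar> \<le> int (fact n * n)"
    using scaled_entry[OF le(2)] by blast
  obtain k where k: "of_int k = of_nat (fact n) * c" "\<bar>k\<bar> \<le> int (fact n * n)"
    using scaled_entry[OF le(3)] by blast
  have "of_int (2 * int (fact n) * k - i * j) =
      (of_nat (fact n) ^ 2 * (2 * c - a * b) :: rat)"
    unfolding of_int_diff of_int_mult i(1) j(1) k(1) by (simp add: algebra_simps power2_eq_square)
  then have "scaled (fact n) M (i, j, 2 * int (fact n) * k - i * j)"
    unfolding scaled_def M using i(1) j(1) by simp
  moreover have "letter_le (entry_bound n) (i, j, 2 * int (fact n) * k - i * j)"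
  proof -
    have "\<bar>i * j\<bar> \<le> int (fact n * n) * int (fact n * n)"
      unfolding abs_mult using i(2) j(2) by (intro mult_mono) auto
    then have ij: "\<bar>i * j\<bar> \<le> int ((fact n * n) * (fact n * n))" by (simp only: of_nat_mult)
    have "\<bar>2 * int (fact n) * k\<bar> \<le> 2 * int (fact n) * int (fact n * n)"
      unfolding abs_mult using k(2) by (intro mult_mono) auto
    then have "\<bar>2 * int (fact n) * k\<bar> \<le> int (2 * fact n * (fact n * n))"
      by (simp only: of_nat_mult of_nat_numeral)
    then have "\<bar>2 * int (fact n) * k - i * j\<bar> \<le> int (2 * fact n * (fact n * n)) + int ((fact n * n) * (fact n * n))"
      using ij abs_triangle_ineq4[of "2 * int (fact n) * k" "i * j"] by linarith
    then show ?thesis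
      using i(2) j(2) unfolding letter_le_def entry_bound_def of_nat_add fst_conv snd_conv
      by (intro conjI; linarith)
  qed
  ultimately show ?thesis by blast
qed

lemma letter_le_mult:
  assumes "letter_le K l" "letter_le K m"
  shows "letter_le (2 * K + 2 * K * K) (letter_mult l m)"
  using assms abs_cross_le[OF assms] unfolding letter_le_def letter_mult_def by auto

lemma letter_le_mono: "letter_le K l \<Longrightarrow> K \<le> K' \<Longrightarrow> letter_le K' l"
  unfolding letter_le_def by auto

lemma subset_image_map:
  assumes "set ys \<subseteq> f ` A"
  obtains xs where "ys = map f xs" "set xs \<subseteq> A"
proof -
  have "ys \<in> lists (f ` A)" using assms by (simp add: lists_eq_set)
  then have "ys \<in> map f ` lists A" by (simp only: lists_image)
  then show ?thesis using that by (auto simp: lists_eq_set)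
qed

text \<open>Semigroup words must be nonempty, while \<open>short_solution\<close> may return empty
  ones. So the first matrix of each word is merged into the base letter and kept, which accounts for
  \<open>Suc\<close> in the length bound.\<close>

lemma short_matrix_solution:
  assumes H3: "T \<in> H3" "S \<in> H3" "set Ms \<subseteq> H3" "set Ns \<subseteq> H3"
    and code: "heis_code T \<le> n" "heis_code S \<le> n"
      "\<forall>M\<in>set Ms \<union> set Ns. heis_code M \<le> n"
    and ne: "Ms \<noteq> []" "Ns \<noteq> []"
    and eq: "T ** foldr (**) Ms (mat 1) = S ** foldr (**) Ns (mat 1)"
  shows "\<exists>Ms' Ns'. Ms' \<noteq> [] \<and> Ns' \<noteq> [] \<and> set Ms' \<subseteq> set Ms \<and> set Ns' \<subseteq> set Ns \<and>
    length Ms' \<le> Suc (search_bound n) \<and> length Ns' \<le> Suc (search_bound n) \<and>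
    T ** foldr (**) Ms' (mat 1) = S ** foldr (**) Ns' (mat 1)"
proof -
  define q :: nat where "q = fact n"
  have q: "q > 0" unfolding q_def by simp
  define K where "K = 2 * entry_bound n + 2 * entry_bound n * entry_bound n"
  have "\<forall>M\<in>{T, S} \<union> set Ms \<union> set Ns. \<exists>l. scaled q M l \<and> letter_le (entry_bound n) l"
    unfolding q_def by (intro ballI scaled_letter) (use H3 code in blast)+
  then obtain f where f: "scaled q M (f M)" "letter_le (entry_bound n) (f M)"
    if "M \<in> {T, S} \<union> set Ms \<union> set Ns" for M
    by metis
  obtain M Ms\<^sub>1 where Ms: "Ms = M # Ms\<^sub>1" using ne(1) by (cases Ms) auto
  obtain N Ns\<^sub>1 where Ns: "Ns = N # Ns\<^sub>1" using ne(2) by (cases Ns) auto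
  define t where "t = letter_mult (f T) (f M)"
  define s where "s = letter_mult (f S) (f N)"
  have tm: "T ** M \<in> H3" "scaled q (T ** M) t" "S ** N \<in> H3" "scaled q (S ** N) s"
    unfolding t_def s_def using H3 f Ms Ns by (auto intro!: H3_mult scaled_mult)
  have val: "T ** foldr (**) (M # Ms') (mat 1) = S ** foldr (**) (N # Ns') (mat 1) \<longleftrightarrow>
      word_value (t # map f Ms') = word_value (s # map f Ns')"
    if "set Ms' \<subseteq> set Ms" "set Ns' \<subseteq> set Ns" for Ms' Ns'
  proof -
    have fold: "foldr (**) Ms' (mat 1) \<in> H3 \<and> scaled q (foldr (**) Ms' (mat 1)) (word_value (map f Ms'))"
      "foldr (**) Ns' (mat 1) \<in> H3 \<and> scaled q (foldr (**) Ns' (mat 1)) (word_value (map f Ns'))"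
      using that H3(3,4) f by (intro scaled_foldr; blast)+
    have "(T ** M) ** foldr (**) Ms' (mat 1) = (S ** N) ** foldr (**) Ns' (mat 1) \<longleftrightarrow>
      word_value (t # map f Ms') = word_value (s # map f Ns')"
      unfolding word_value_Cons
      using tm fold q by (intro scaled_eq_iff[of _ _ q]) (auto intro!: H3_mult scaled_mult)
    then show ?thesis by (simp add: matrix_mul_assoc)
  qed
  have le: "\<forall>l\<in>set (t # s # map f Ms\<^sub>1 @ map f Ns\<^sub>1). letter_le K l"
  proof -
    have "letter_le K t" "letter_le K s"
      unfolding t_def s_def K_def using f Ms Ns by (auto intro!: letter_le_mult)
    moreover have "letter_le K (f L)" if "L \<in> set Ms\<^sub>1 \<union> set Ns\<^sub>1" for L
      by (rule letter_le_mono[OF f(2)]) (use that Ms Ns in \<open>auto simp: K_def\<close>)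
    ultimately show ?thesis by auto
  qed
  have "word_value (t # map f Ms\<^sub>1) = word_value (s # map f Ns\<^sub>1)"
    using val[of Ms\<^sub>1 Ns\<^sub>1] eq Ms Ns by auto
  then have "wx (t # map f Ms\<^sub>1) = wx (s # map f Ns\<^sub>1)" "wy (t # map f Ms\<^sub>1) = wy (s # map f Ns\<^sub>1)"
    "wz (t # map f Ms\<^sub>1) = wz (s # map f Ns\<^sub>1)"
    unfolding word_value_def by blast+
  from short_solution[OF le this] obtain g h where gh: "set g \<subseteq> f ` set Ms\<^sub>1" "set h \<subseteq> f ` set Ns\<^sub>1"
    "word_value (t # g) = word_value (s # h)" "length g \<le> word_bound K" "length h \<le> word_bound K"
    unfolding word_value_def by auto
  obtain Ms' where Ms': "g = map f Ms'" "set Ms' \<subseteq> set Ms\<^sub>1"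
    by (rule subset_image_map[OF gh(1)])
  obtain Ns' where Ns': "h = map f Ns'" "set Ns' \<subseteq> set Ns\<^sub>1"
    by (rule subset_image_map[OF gh(2)])
  have sub: "set Ms' \<subseteq> set Ms" "set Ns' \<subseteq> set Ns" using Ms'(2) Ns'(2) Ms Ns by auto
  have "T ** foldr (**) (M # Ms') (mat 1) = S ** foldr (**) (N # Ns') (mat 1)"
    using val[OF sub] gh(3) Ms'(1) Ns'(1) by simp
  moreover have "length (M # Ms') \<le> Suc (search_bound n)" "length (N # Ns') \<le> Suc (search_bound n)"
    using gh(4,5) Ms'(1) Ns'(1) unfolding search_bound_def K_def by simp_all
  moreover have "set (M # Ms') \<subseteq> set Ms" "set (N # Ns') \<subseteq> set Ns" using sub Ms Ns by simp_all
  ultimately show ?thesis by blast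
qed

section \<open>Instances as triples of fractions, and the decision procedure\<close>

definition fraction_of :: "rat \<Rightarrow> fraction" where
  "fraction_of r = (case quotient_of r of (k, d) \<Rightarrow> (k, nat d))"

definition triple_of :: "rat^3^3 \<Rightarrow> triple" where
  "triple_of M = (fraction_of (M $ 1 $ 2), fraction_of (M $ 2 $ 3), fraction_of (M $ 1 $ 3))"

lemma code_fraction_of: "code (fraction_of r) = rat_code r"
  by (simp add: fraction_of_def rat_code_def code_Pair code_int_def split: prod.split)

lemma code_triple_of: "code (triple_of M) = heis_code M"
  by (simp add: triple_of_def heis_code_def code_Pair code_fraction_of)

lemma frac_val_fraction_of: "frac_val (fraction_of r) = r" "snd (fraction_of r) > 0"
proof -
  obtain k d where kd: "quotient_of r = (k, d)" by fastforce
  have "d > 0" "r = of_int k / of_int d"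
    using quotient_of_denom_pos[OF kd] quotient_of_div[OF kd] by auto
  moreover have "fraction_of r = (k, nat d)" by (simp add: fraction_of_def kd)
  ultimately show "frac_val (fraction_of r) = r" "snd (fraction_of r) > 0"
    by (simp_all add: frac_val_def)
qed

lemma triple_val_triple_of: "M \<in> H3 \<Longrightarrow> triple_val (triple_of M) = M"
  by (auto simp: H3_def triple_val_def triple_of_def frac_val_fraction_of)

lemma proper_triple_of: "proper (triple_of M)"
  by (simp add: proper_def triple_of_def frac_val_fraction_of)

lemma le_list_encode: "n \<in> set ns \<Longrightarrow> n \<le> list_encode ns"
  by (induction ns)
    (auto intro: le_SucI le_prod_encode_1 order_trans[OF _ le_prod_encode_2])

text \<open>The code from the type class is literally the prescribed instance code, so the program
  for \<open>orbits_disjoint\<close> runs on the given input without any translation.\<close>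

lemma code_instance:
  "code (triple_of T, triple_of S, map triple_of Gs, map triple_of Hs) = instance_code (T, S, Gs, Hs)"
  by (simp add: code_Pair code_triple_of code_list_def o_def)

text \<open>Pairing dominates its components, so the code of the instance serves as a bound for all
  its entries.\<close>

lemma heis_code_le_instance_code:
  "heis_code T \<le> instance_code (T, S, Gs, Hs)" "heis_code S \<le> instance_code (T, S, Gs, Hs)"
  "M \<in> set Gs \<union> set Hs \<Longrightarrow> heis_code M \<le> instance_code (T, S, Gs, Hs)"
proof -
  show "heis_code T \<le> instance_code (T, S, Gs, Hs)" by (simp add: le_prod_encode_1)
  show "heis_code S \<le> instance_code (T, S, Gs, Hs)"
    unfolding instance_code.simps by (meson le_prod_encode_1 le_prod_encode_2 order_trans)
  assume "M \<in> set Gs \<union> set Hs"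
  then have "heis_code M \<le> list_encode (map heis_code Gs) \<or> heis_code M \<le> list_encode (map heis_code Hs)"
    by (auto intro: le_list_encode)
  then show "heis_code M \<le> instance_code (T, S, Gs, Hs)"
    unfolding instance_code.simps by (meson le_prod_encode_1 le_prod_encode_2 order_trans)
qed

lemma orbits_disjoint_iff:
  assumes "(T, S, Gs, Hs) \<in> coset_instances"
  shows "orbits_disjoint (triple_of T, triple_of S, map triple_of Gs, map triple_of Hs) \<longleftrightarrow>
    (\<lambda>M. T ** M) ` semigroup_gen (set Gs) \<inter> (\<lambda>M. S ** M) ` semigroup_gen (set Hs) = {}"
proof -
  have H3: "T \<in> H3" "S \<in> H3" "set Gs \<subseteq> H3" "set Hs \<subseteq> H3"
    using assms unfolding coset_instances_def by auto
  define n where "n = instance_code (T, S, Gs, Hs)"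
  define O\<^sub>T where "O\<^sub>T = orbit (search_bound n) (triple_of T) (map triple_of Gs)"
  define O\<^sub>S where "O\<^sub>S = orbit (search_bound n) (triple_of S) (map triple_of Hs)"
  have vals: "triple_val ` set (map triple_of Gs) = set Gs" "triple_val ` set (map triple_of Hs) = set Hs"
    using H3(3,4) by (force simp: image_image triple_val_triple_of subset_iff)+
  have val: "triple_val ` set O\<^sub>T = {T ** foldr (**) Ms (mat 1) | Ms.
      Ms \<noteq> [] \<and> set Ms \<subseteq> set Gs \<and> length Ms \<le> Suc (search_bound n)}"
    "triple_val ` set O\<^sub>S = {S ** foldr (**) Ms (mat 1) | Ms.
      Ms \<noteq> [] \<and> set Ms \<subseteq> set Hs \<and> length Ms \<le> Suc (search_bound n)}"
    unfolding O\<^sub>T_def O\<^sub>S_def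
    by (subst orbit_val, simp add: proper_triple_of, simp add: proper_triple_of,
        simp only: vals triple_val_triple_of[OF H3(1)] triple_val_triple_of[OF H3(2)])+
  have proper: "\<forall>u\<in>set O\<^sub>T. proper u" "\<forall>v\<in>set O\<^sub>S. proper v"
    unfolding O\<^sub>T_def O\<^sub>S_def by (intro orbit_proper; simp add: proper_triple_of)+
  have "orbits_disjoint (triple_of T, triple_of S, map triple_of Gs, map triple_of Hs) \<longleftrightarrow>
      \<not> (\<exists>u\<in>set O\<^sub>T. \<exists>v\<in>set O\<^sub>S. triple_eq u v)"
    unfolding orbits_disjoint_def code_instance O\<^sub>T_def O\<^sub>S_def n_def by (simp add: list_ex_iff)
  also have "\<dots> \<longleftrightarrow> triple_val ` set O\<^sub>T \<inter> triple_val ` set O\<^sub>S = {}"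
    using proper triple_eq_iff by (auto simp: disjoint_iff image_iff)
  also have "\<dots> \<longleftrightarrow> (\<lambda>M. T ** M) ` semigroup_gen (set Gs) \<inter> (\<lambda>M. S ** M) ` semigroup_gen (set Hs) = {}"
    (is "_ \<longleftrightarrow> ?A \<inter> ?B = {}")
  proof
    assume disj: "triple_val ` set O\<^sub>T \<inter> triple_val ` set O\<^sub>S = {}"
    show "?A \<inter> ?B = {}"
    proof (rule ccontr)
      \<comment> \<open>Any common point can be traded for one inside the search radius.\<close>
      assume "?A \<inter> ?B \<noteq> {}"
      then obtain Ms Ns where MN: "Ms \<noteq> []" "set Ms \<subseteq> set Gs" "Ns \<noteq> []" "set Ns \<subseteq> set Hs"
        "T ** foldr (**) Ms (mat 1) = S ** foldr (**) Ns (mat 1)"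
        unfolding semigroup_gen_def by (auto 0 4)
      have sub: "set Ms \<subseteq> H3" "set Ns \<subseteq> H3" using MN H3 by auto
      have le: "\<forall>M\<in>set Ms \<union> set Ns. heis_code M \<le> n"
        using heis_code_le_instance_code(3)[of _ Gs Hs T S] MN(2,4) unfolding n_def by blast
      have le_TS: "heis_code T \<le> n" "heis_code S \<le> n"
        unfolding n_def by (rule heis_code_le_instance_code)+
      from short_matrix_solution[OF H3(1,2) sub le_TS le MN(1,3,5)]
      obtain Ms' Ns' where "Ms' \<noteq> []" "Ns' \<noteq> []" "set Ms' \<subseteq> set Ms" "set Ns' \<subseteq> set Ns"
        "length Ms' \<le> Suc (search_bound n)" "length Ns' \<le> Suc (search_bound n)"
        "T ** foldr (**) Ms' (mat 1) = S ** foldr (**) Ns' (mat 1)"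
        by blast
      then have "T ** foldr (**) Ms' (mat 1) \<in> triple_val ` set O\<^sub>T \<inter> triple_val ` set O\<^sub>S"
        unfolding val using MN(2,4) by blast
      with disj show False by blast
    qed
  next
    assume "?A \<inter> ?B = {}"
    moreover have "triple_val ` set O\<^sub>T \<subseteq> ?A" "triple_val ` set O\<^sub>S \<subseteq> ?B"
      unfolding val semigroup_gen_def by blast+
    ultimately show "triple_val ` set O\<^sub>T \<inter> triple_val ` set O\<^sub>S = {}" by blast
  qed
  finally show ?thesis .
qed

theorem theorem3:
  "decidable_on coset_instances instance_code
     (\<lambda>(T, S, Gs, Hs).
        (\<lambda>M. T ** M) ` semigroup_gen (set Gs) \<inter> (\<lambda>M. S ** M) ` semigroup_gen (set Hs) = {})"
proof -
  obtain r where r: "\<And>I. computes r [code I] (code (orbits_disjoint I))"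
    using computable_orbits_disjoint unfolding computable_def by blast
  show ?thesis
    unfolding decidable_on_def
  proof (intro exI[of _ r] ballI)
    fix x assume "x \<in> coset_instances"
    moreover obtain T S Gs Hs where x: "x = (T, S, Gs, Hs)" by (cases x)
    ultimately have "code (orbits_disjoint (triple_of T, triple_of S, map triple_of Gs, map triple_of Hs)) =
      (if (\<lambda>M. T ** M) ` semigroup_gen (set Gs) \<inter> (\<lambda>M. S ** M) ` semigroup_gen (set Hs) = {} then 1 else 0)"
      by (simp add: orbits_disjoint_iff code_bool_def)
    then show "computes r [instance_code x]
        (if case x of (T, S, Gs, Hs) \<Rightarrow>
           (\<lambda>M. T ** M) ` semigroup_gen (set Gs) \<inter> (\<lambda>M. S ** M) ` semigroup_gen (set Hs) = {}
         then 1 else 0)"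
      using r[of "(triple_of T, triple_of S, map triple_of Gs, map triple_of Hs)"]
      unfolding x code_instance by simp
  qed
qed

end
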